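(* Let $G$ be a finite group, let $\rho:G\to\mathrm{GL}(V)$ be a finite-dimensional complex representation, and let $N=\ker\rho$. The number of connected components of the McKay quiver $\Gamma_\rho(G)$ is equal to the number of conjugacy classes of $G$ contained in $N$.
   Context: Let $\sigma_1,\dots,\sigma_r$ be a complete list of the irreducible complex representations of $G$ up to isomorphism, with $\sigma_1$ trivial. The McKay matrix $A_\rho(G)=(a_{ij})_{i,j=1}^r$ has as entries the non-negative integers determined by $\rho\otimes\sigma_i\cong\bigoplus_{j=1}^r\sigma_j^{\oplus a_{ij}}$. The McKay quiver $\Gamma_\rho(G)$ is the quiver with vertices $v_1,\dots,v_r$ and $a_{ij}$ directed edges from $v_i$ to $v_j$. A connected component of $\Gamma_\rho(G)$ means a strongly connected component (maximal subquiver in which there is a directed path, possibly of length $0$, from any vertex to any other) or equivalently a weakly connected component (connected component after forgetting edge directions); for McKay quivers these two notions coincide. *)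

theory Defs
  imports
    "HOL-Algebra.Group_Action"
    "Jordan_Normal_Form.VS_Connect"
    "Graph_Theory.Digraph_Component"
begin

section \<open>Finite-dimensional complex representations\<close>

text \<open>
  A representation on an \<open>n\<close>-dimensional space is a homomorphism into the group of invertible
  complex \<open>n \<times> n\<close> matrices; \<open>n = 0\<close> is allowed. Only the values on the carrier of the group
  are meaningful.
\<close>

definition GL :: "nat \<Rightarrow> complex mat monoid" where
  "GL n = units_of (ring_mat TYPE(complex) n ())"

text \<open>The degree is read off from the size of the matrix representing the identity.\<close>

definition rep_degree :: "('g, 'b) monoid_scheme \<Rightarrow> ('g \<Rightarrow> complex mat) \<Rightarrow> nat" where
  "rep_degree G \<rho> = dim_row (\<rho> \<one>\<^bsub>G\<^esub>)"

definition representation :: "('g, 'b) monoid_scheme \<Rightarrow> ('g \<Rightarrow> complex mat) \<Rightarrow> bool" where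
  "representation G \<rho> \<longleftrightarrow> \<rho> \<in> hom G (GL (rep_degree G \<rho>))"

lemma representation_iff:
  assumes "group G"
  shows "representation G \<rho> \<longleftrightarrow> (\<exists>n. \<rho> \<in> hom G (GL n))"
proof
  assume "\<exists>n. \<rho> \<in> hom G (GL n)"
  then obtain n where n: "\<rho> \<in> hom G (GL n)" by blast
  have "\<one>\<^bsub>G\<^esub> \<in> carrier G"
    using assms by (simp add: group.is_monoid monoid.one_closed)
  with n have "\<rho> \<one>\<^bsub>G\<^esub> \<in> carrier (GL n)" by (auto simp: hom_def)
  then have "rep_degree G \<rho> = n"
    by (auto simp: GL_def units_of_def Units_def ring_mat_def rep_degree_def)
  with n show "representation G \<rho>" by (simp add: representation_def)
qed (auto simp: representation_def)

text \<open>
  \<open>P\<close> is the matrix of an intertwining isomorphism. As \<open>invertible_mat\<close> forces \<open>P\<close> to be square,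
  isomorphic representations have the same degree.
\<close>

definition rep_iso ::
    "('g, 'b) monoid_scheme \<Rightarrow> ('g \<Rightarrow> complex mat) \<Rightarrow> ('g \<Rightarrow> complex mat) \<Rightarrow> bool" where
  "rep_iso G \<rho> \<sigma> \<longleftrightarrow>
     (\<exists>P \<in> carrier_mat (rep_degree G \<sigma>) (rep_degree G \<rho>).
        invertible_mat P \<and> (\<forall>g \<in> carrier G. P * \<rho> g = \<sigma> g * P))"

definition irreducible_rep :: "('g, 'b) monoid_scheme \<Rightarrow> ('g \<Rightarrow> complex mat) \<Rightarrow> bool" where
  "irreducible_rep G \<rho> \<longleftrightarrow>
     representation G \<rho> \<and> rep_degree G \<rho> \<noteq> 0 \<and>
     (\<forall>W. VectorSpace.subspace class_ring W (module_vec TYPE(complex) (rep_degree G \<rho>)) \<and>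
          (\<forall>g \<in> carrier G. \<forall>w \<in> W. \<rho> g *\<^sub>v w \<in> W) \<longrightarrow>
          W = {0\<^sub>v (rep_degree G \<rho>)} \<or> W = carrier_vec (rep_degree G \<rho>))"

definition trivial_rep :: "('g, 'b) monoid_scheme \<Rightarrow> ('g \<Rightarrow> complex mat) \<Rightarrow> bool" where
  "trivial_rep G \<rho> \<longleftrightarrow> (\<forall>g \<in> carrier G. \<rho> g = 1\<^sub>m 1)"

text \<open>
  The Kronecker product: the matrix of the tensor product of two linear maps in the
  lexicographically ordered basis of the \<open>e\<^sub>i \<otimes> f\<^sub>j\<close>.
\<close>

definition kronecker :: "complex mat \<Rightarrow> complex mat \<Rightarrow> complex mat" where
  "kronecker A B = mat (dim_row A * dim_row B) (dim_col A * dim_col B)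
     (\<lambda>(i, j). A $$ (i div dim_row B, j div dim_col B) * B $$ (i mod dim_row B, j mod dim_col B))"

definition tensor_rep ::
    "('g \<Rightarrow> complex mat) \<Rightarrow> ('g \<Rightarrow> complex mat) \<Rightarrow> 'g \<Rightarrow> complex mat" where
  "tensor_rep \<rho> \<sigma> = (\<lambda>g. kronecker (\<rho> g) (\<sigma> g))"

definition direct_sum_rep :: "('g \<Rightarrow> complex mat) list \<Rightarrow> 'g \<Rightarrow> complex mat" where
  "direct_sum_rep \<tau>s = (\<lambda>g. diag_block_mat (map (\<lambda>\<tau>. \<tau> g) \<tau>s))"

definition complete_irreps :: "('g, 'b) monoid_scheme \<Rightarrow> ('g \<Rightarrow> complex mat) list \<Rightarrow> bool" where
  "complete_irreps G \<sigma>s \<longleftrightarrow>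
     (\<forall>i < length \<sigma>s. irreducible_rep G (\<sigma>s ! i)) \<and>
     (\<forall>i < length \<sigma>s. \<forall>j < length \<sigma>s. i \<noteq> j \<longrightarrow> \<not> rep_iso G (\<sigma>s ! i) (\<sigma>s ! j)) \<and>
     (\<forall>\<tau>. irreducible_rep G \<tau> \<longrightarrow> (\<exists>i < length \<sigma>s. rep_iso G \<tau> (\<sigma>s ! i)))"


section \<open>The McKay matrix and the McKay quiver\<close>

text \<open>
  Indices start at \<open>0\<close>, so \<open>\<sigma>s ! i\<close> is the representation usually written \<open>\<sigma>\<^sub>i\<^sub>+\<^sub>1\<close>. For a complete
  list of irreducible representations of a finite group, the matrix below exists and is unique
  by complete reducibility and the Krull-Schmidt property.
\<close>

definition mckay_matrix ::
    "('g, 'b) monoid_scheme \<Rightarrow> ('g \<Rightarrow> complex mat) \<Rightarrow> ('g \<Rightarrow> complex mat) list \<Rightarrow> nat mat" where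
  "mckay_matrix G \<rho> \<sigma>s =
     (THE A. A \<in> carrier_mat (length \<sigma>s) (length \<sigma>s) \<and>
        (\<forall>i < length \<sigma>s. rep_iso G (tensor_rep \<rho> (\<sigma>s ! i))
           (direct_sum_rep
              (concat (map (\<lambda>j. replicate (A $$ (i, j)) (\<sigma>s ! j)) [0..<length \<sigma>s])))))"

text \<open>The arcs from \<open>i\<close> to \<open>j\<close> are the triples \<open>(i, j, k)\<close> with \<open>k < a\<^sub>i\<^sub>j\<close>.\<close>

definition mckay_quiver ::
    "('g, 'b) monoid_scheme \<Rightarrow> ('g \<Rightarrow> complex mat) \<Rightarrow> ('g \<Rightarrow> complex mat) list
      \<Rightarrow> (nat, nat \<times> nat \<times> nat) pre_digraph" where
  "mckay_quiver G \<rho> \<sigma>s =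
     \<lparr> verts = {..<length \<sigma>s},
       arcs = {(i, j, k). i < length \<sigma>s \<and> j < length \<sigma>s \<and> k < mckay_matrix G \<rho> \<sigma>s $$ (i, j)},
       tail = (\<lambda>(i, j, k). i),
       head = (\<lambda>(i, j, k). j) \<rparr>"

definition conj_classes :: "('g, 'b) monoid_scheme \<Rightarrow> 'g set set" where
  "conj_classes G =
     orbits G (carrier G) (\<lambda>g. \<lambda>h \<in> carrier G. g \<otimes>\<^bsub>G\<^esub> h \<otimes>\<^bsub>G\<^esub> inv\<^bsub>G\<^esub> g)"

end

theory Submission
  imports Defs "Jordan_Normal_Form.Spectral_Radius" "HOL-Algebra.Multiplicative_Group"
begin

text \<open>
  Let \<open>d\<close> be the vector of degrees of the irreducible representations, \<open>n\<close> the degree of \<open>\<rho>\<close> and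
  \<open>A\<close> the McKay matrix. The columns of the character table are eigenvectors of \<open>A\<close>: the column at
  \<open>g\<close> has eigenvalue \<open>\<chi> g\<close>, where \<open>\<chi>\<close> is the character of \<open>\<rho>\<close>, and \<open>\<chi> g = n\<close> exactly for \<open>g\<close> in
  the kernel. Since \<open>d\<close> is both a left and a right eigenvector of \<open>A\<close> for \<open>n\<close>, the weights
  \<open>d i * A i j * d j\<close> form a balanced flow on the quiver. Hence reachability is symmetric, and the
  eigenvectors for \<open>n\<close> are the multiples of \<open>d\<close> that are constant on each component. So averaging
  over components fixes the columns at elements of the kernel and annihilates the others. Its trace
  is the number of components; evaluated in the basis of columns by the orthogonality relations, it
  is the sum of \<open>1 / \<bar>class of g\<bar>\<close> over \<open>g\<close> in the kernel, which is the number of classes in the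
  kernel.
\<close>

section \<open>Matrices\<close>

text \<open>The McKay matrix is given by a definite description, so nothing about it can be used
  before existence and uniqueness are shown. Existence is Maschke's theorem; uniqueness comes from
  orthogonality of characters, which recovers every multiplicity. This is why representation theory
  is built from Schur's lemma upwards before the quiver appears. The vector \<open>d\<close> is a
  left eigenvector because \<open>\<Sum>i. d i * \<chi>\<^sub>i\<close> is the regular character: it
  is supported at the identity, where \<open>\<chi>\<close> takes the value \<open>n\<close>, so
  multiplying it by \<open>\<chi>\<close> only scales it by \<open>n\<close>. The McKay matrix is in
  general not symmetric, so its eigenvectors are not reached through self-adjointness. The balance
  of the flow takes that role: it makes the Dirichlet energy of an eigenvector for \<open>n\<close>
  vanish. The columns are indexed by all group elements, not by class representatives. Row
  orthogonality says that the columns at \<open>g\<close> and at \<open>inv g\<close>, paired and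
  summed over \<open>g\<close>, give \<open>card (carrier G)\<close> times the identity. A trace is
  therefore a sum over \<open>g\<close>, and each \<open>g\<close> of the kernel enters with the
  share \<open>1 / card (conj_class g)\<close>.\<close>

definition mtrace :: "complex mat \<Rightarrow> complex" where
  "mtrace A = (\<Sum>i<dim_row A. A $$ (i, i))"

lemma index_mult_mat_sum:
  assumes "A \<in> carrier_mat m k" "B \<in> carrier_mat k n" "i < m" "j < n"
  shows "(A * B) $$ (i, j) = (\<Sum>l<k. A $$ (i, l) * B $$ (l, j))"
  using assms by (simp add: scalar_prod_def lessThan_atLeast0)

lemma mtrace_mult_comm:
  assumes "A \<in> carrier_mat m n" "B \<in> carrier_mat n m"
  shows "mtrace (A * B) = mtrace (B * A)"
proof -
  have "mtrace (A * B) = (\<Sum>i<m. \<Sum>l<n. A $$ (i, l) * B $$ (l, i))"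
    using assms by (auto simp: mtrace_def index_mult_mat_sum simp del: index_mult_mat(1))
  also have "\<dots> = (\<Sum>l<n. \<Sum>i<m. B $$ (l, i) * A $$ (i, l))"
    by (subst sum.swap) (simp add: mult.commute)
  also have "\<dots> = mtrace (B * A)"
    using assms by (auto simp: mtrace_def index_mult_mat_sum simp del: index_mult_mat(1))
  finally show ?thesis .
qed

lemma mtrace_one [simp]: "mtrace (1\<^sub>m n) = of_nat n"
  by (simp add: mtrace_def)

lemma mtrace_four_block:
  assumes "A \<in> carrier_mat m m" "D \<in> carrier_mat n n"
  shows "mtrace (four_block_mat A B C D) = mtrace A + mtrace D"
proof -
  have "(\<Sum>i<m + n. if i < m then A $$ (i, i) else D $$ (i - m, i - m)) =
        (\<Sum>i<m. A $$ (i, i)) + (\<Sum>i<n. D $$ (i, i))"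
    by (induction n) (simp_all add: add.assoc)
  moreover have "mtrace (four_block_mat A B C D) =
      (\<Sum>i<m + n. if i < m then A $$ (i, i) else D $$ (i - m, i - m))"
    using assms by (auto simp: mtrace_def intro!: sum.cong)
  ultimately show ?thesis using assms by (simp add: mtrace_def)
qed

text \<open>\<open>P * Q\<close> and \<open>Q * P\<close> have the same trace, and over the complex
  numbers the trace of an identity matrix determines its size.\<close>

lemma inverse_imp_same_size:
  assumes P: "P \<in> carrier_mat m n" and Q: "Q \<in> carrier_mat n m"
    and "P * Q = 1\<^sub>m m" "Q * P = (1\<^sub>m n :: complex mat)"
  shows "m = n"
  using mtrace_mult_comm[OF P Q] assms by simp

text \<open>A zero matrix depends on its dimensions, so the size of the sum, in particular of an
  empty one, is passed explicitly.\<close>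

definition msum :: "nat \<Rightarrow> nat \<Rightarrow> ('i \<Rightarrow> complex mat) \<Rightarrow> 'i set \<Rightarrow> complex mat" where
  "msum m n f S = mat m n (\<lambda>ij. \<Sum>s\<in>S. f s $$ ij)"

lemma msum_carrier [simp]: "msum m n f S \<in> carrier_mat m n"
  by (simp add: msum_def)

lemma msum_index [simp]: "i < m \<Longrightarrow> j < n \<Longrightarrow> msum m n f S $$ (i, j) = (\<Sum>s\<in>S. f s $$ (i, j))"
  by (simp add: msum_def)

lemma msum_dim [simp]: "dim_row (msum m n f S) = m" "dim_col (msum m n f S) = n"
  by (simp_all add: msum_def)

lemma mult_msum:
  assumes A: "A \<in> carrier_mat p m" and f: "\<And>s. s \<in> S \<Longrightarrow> f s \<in> carrier_mat m n"
  shows "A * msum m n f S = msum p n (\<lambda>s. A * f s) S"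
proof (rule eq_matI)
  fix i j assume "i < dim_row (msum p n (\<lambda>s. A * f s) S)" "j < dim_col (msum p n (\<lambda>s. A * f s) S)"
  then have ij: "i < p" "j < n" by auto
  have "(A * msum m n f S) $$ (i, j) = (\<Sum>l<m. \<Sum>s\<in>S. A $$ (i, l) * f s $$ (l, j))"
    using ij by (subst index_mult_mat_sum[OF A msum_carrier]) (auto simp: sum_distrib_left)
  also have "\<dots> = (\<Sum>s\<in>S. \<Sum>l<m. A $$ (i, l) * f s $$ (l, j))" by (rule sum.swap)
  also have "\<dots> = (\<Sum>s\<in>S. (A * f s) $$ (i, j))"
    using ij f by (intro sum.cong refl) (simp add: index_mult_mat_sum[OF A f] del: index_mult_mat(1))
  finally show "(A * msum m n f S) $$ (i, j) = msum p n (\<lambda>s. A * f s) S $$ (i, j)"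
    using ij by simp
qed (use A in auto)

lemma msum_mult:
  assumes A: "A \<in> carrier_mat n p" and f: "\<And>s. s \<in> S \<Longrightarrow> f s \<in> carrier_mat m n"
  shows "msum m n f S * A = msum m p (\<lambda>s. f s * A) S"
proof (rule eq_matI)
  fix i j assume "i < dim_row (msum m p (\<lambda>s. f s * A) S)" "j < dim_col (msum m p (\<lambda>s. f s * A) S)"
  then have ij: "i < m" "j < p" by auto
  have "(msum m n f S * A) $$ (i, j) = (\<Sum>l<n. \<Sum>s\<in>S. f s $$ (i, l) * A $$ (l, j))"
    using ij by (subst index_mult_mat_sum[OF msum_carrier A]) (auto simp: sum_distrib_right)
  also have "\<dots> = (\<Sum>s\<in>S. \<Sum>l<n. f s $$ (i, l) * A $$ (l, j))" by (rule sum.swap)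
  also have "\<dots> = (\<Sum>s\<in>S. (f s * A) $$ (i, j))"
    using ij f by (intro sum.cong refl) (simp add: index_mult_mat_sum[OF f A] del: index_mult_mat(1))
  finally show "(msum m n f S * A) $$ (i, j) = msum m p (\<lambda>s. f s * A) S $$ (i, j)"
    using ij by simp
qed (use A in auto)

lemma mtrace_msum:
  assumes "\<And>s. s \<in> S \<Longrightarrow> f s \<in> carrier_mat n n"
  shows "mtrace (msum n n f S) = (\<Sum>s\<in>S. mtrace (f s))"
proof -
  have "mtrace (msum n n f S) = (\<Sum>s\<in>S. \<Sum>i<n. f s $$ (i, i))"
    unfolding mtrace_def by (subst sum.swap) simp
  also have "\<dots> = (\<Sum>s\<in>S. mtrace (f s))"
    using assms by (intro sum.cong refl) (auto simp: mtrace_def)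
  finally show ?thesis .
qed

lemma msum_cong:
  "(\<And>s. s \<in> S \<Longrightarrow> f s = g s) \<Longrightarrow> msum m n f S = msum m n g S"
  by (auto simp: msum_def intro!: cong_mat)

lemma msum_reindex:
  assumes "bij_betw h S T"
  shows "msum m n (\<lambda>s. f (h s)) S = msum m n f T"
  unfolding msum_def
  using sum.reindex_bij_betw[OF assms, of "\<lambda>t. f t $$ (_, _)"] by (intro cong_mat refl) blast

text \<open>An index of a Kronecker product encodes a pair of indices as quotient and remainder;
  this turns a sum over such indices into a double sum.\<close>

lemma sum_lessThan_mult:
  fixes F :: "nat \<Rightarrow> nat \<Rightarrow> 'a::comm_monoid_add"
  shows "(\<Sum>k<m * n. F (k div n) (k mod n)) = (\<Sum>i<m. \<Sum>j<n. F i j)"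
proof -
  have "(\<Sum>k<m * n. F (k div n) (k mod n)) =
        (\<Sum>i<m. \<Sum>k = i * n..<i * n + n. F (k div n) (k mod n))"
    by (rule sum.nat_group[symmetric])
  also have "\<dots> = (\<Sum>i<m. \<Sum>j<n. F i j)"
  proof (rule sum.cong[OF refl])
    fix i
    have "(\<Sum>k = i * n..<i * n + n. F (k div n) (k mod n)) =
          (\<Sum>j = 0..<n. F ((j + i * n) div n) ((j + i * n) mod n))"
      using sum.shift_bounds_nat_ivl[of "\<lambda>k. F (k div n) (k mod n)" 0 "i * n" n] by (simp add: add.commute)
    then show "(\<Sum>k = i * n..<i * n + n. F (k div n) (k mod n)) = (\<Sum>j<n. F i j)"
      by (simp add: atLeast0LessThan)
  qed
  finally show ?thesis .
qed

lemma kronecker_carrier [simp]: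
  "A \<in> carrier_mat m n \<Longrightarrow> B \<in> carrier_mat p q \<Longrightarrow> kronecker A B \<in> carrier_mat (m * p) (n * q)"
  by (auto simp: kronecker_def)

lemma kronecker_index:
  assumes "A \<in> carrier_mat m n" "B \<in> carrier_mat p q" "i < m * p" "j < n * q"
  shows "kronecker A B $$ (i, j) = A $$ (i div p, j div q) * B $$ (i mod p, j mod q)"
  using assms by (auto simp: kronecker_def)

lemma div_mod_less_mult:
  assumes "(i::nat) < m * p" shows "i div p < m" "i mod p < p"
  using assms by (metis less_mult_imp_div_less, metis mod_less_divisor gr0I mult_0_right not_less_zero)

lemma kronecker_mult:
  assumes A: "A \<in> carrier_mat m n" and B: "B \<in> carrier_mat p q"
    and C: "C \<in> carrier_mat n r" and D: "D \<in> carrier_mat q s"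
  shows "kronecker A B * kronecker C D = kronecker (A * C) (B * D)"
proof (rule eq_matI)
  note AB = kronecker_carrier[OF A B] and CD = kronecker_carrier[OF C D]
  have AC: "A * C \<in> carrier_mat m r" and BD: "B * D \<in> carrier_mat p s"
    using assms by auto
  note K = kronecker_carrier[OF AC BD]
  fix i j assume "i < dim_row (kronecker (A * C) (B * D))" "j < dim_col (kronecker (A * C) (B * D))"
  with K have ij: "i < m * p" "j < r * s" by auto
  note dm = div_mod_less_mult[OF ij(1)] div_mod_less_mult[OF ij(2)]
  have "(kronecker A B * kronecker C D) $$ (i, j) =
      (\<Sum>k<n * q. A $$ (i div p, k div q) * B $$ (i mod p, k mod q) *
        (C $$ (k div q, j div s) * D $$ (k mod q, j mod s)))"
    using ij by (subst index_mult_mat_sum[OF AB CD])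
      (auto intro!: sum.cong simp: kronecker_index[OF A B] kronecker_index[OF C D])
  also have "\<dots> = (\<Sum>k<n. \<Sum>l<q. A $$ (i div p, k) * B $$ (i mod p, l) *
        (C $$ (k, j div s) * D $$ (l, j mod s)))"
    by (rule sum_lessThan_mult)
  also have "\<dots> = (\<Sum>k<n. A $$ (i div p, k) * C $$ (k, j div s)) *
                  (\<Sum>l<q. B $$ (i mod p, l) * D $$ (l, j mod s))"
    by (simp add: sum_product ac_simps)
  also have "\<dots> = kronecker (A * C) (B * D) $$ (i, j)"
    using ij dm by (simp add: kronecker_index[OF AC BD] index_mult_mat_sum[OF A C]
        index_mult_mat_sum[OF B D] del: index_mult_mat(1))
  finally show "(kronecker A B * kronecker C D) $$ (i, j) = kronecker (A * C) (B * D) $$ (i, j)" .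
qed (use assms in \<open>auto simp: kronecker_def\<close>)

lemma kronecker_one: "kronecker (1\<^sub>m m) (1\<^sub>m n) = 1\<^sub>m (m * n)"
proof (rule eq_matI)
  fix i j assume "i < dim_row (1\<^sub>m (m * n) :: complex mat)" "j < dim_col (1\<^sub>m (m * n) :: complex mat)"
  then have ij: "i < m * n" "j < m * n" by auto
  have "i = j \<longleftrightarrow> i div n = j div n \<and> i mod n = j mod n"
    by (metis div_mult_mod_eq)
  then show "kronecker (1\<^sub>m m) (1\<^sub>m n) $$ (i, j) = 1\<^sub>m (m * n) $$ (i, j)"
    using ij div_mod_less_mult[OF ij(1)] div_mod_less_mult[OF ij(2)]
    by (auto simp: kronecker_index[OF one_carrier_mat one_carrier_mat])
qed (auto simp: kronecker_def)

lemma mtrace_kronecker: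
  assumes A: "A \<in> carrier_mat m m" and B: "B \<in> carrier_mat n n"
  shows "mtrace (kronecker A B) = mtrace A * mtrace B"
proof -
  have "mtrace (kronecker A B) = (\<Sum>k<m * n. A $$ (k div n, k div n) * B $$ (k mod n, k mod n))"
    using kronecker_carrier[OF A B] by (auto simp: mtrace_def kronecker_index[OF A B])
  also have "\<dots> = (\<Sum>i<m. \<Sum>j<n. A $$ (i, i) * B $$ (j, j))"
    by (rule sum_lessThan_mult)
  also have "\<dots> = mtrace A * mtrace B"
    using A B by (simp add: mtrace_def sum_product)
  finally show ?thesis .
qed

lemma det_nonzero_obtain_inverse:
  assumes "A \<in> carrier_mat n n" "det A \<noteq> (0 :: 'a :: field)"
  obtains B where "B \<in> carrier_mat n n" "A * B = 1\<^sub>m n" "B * A = 1\<^sub>m n"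
  using det_non_zero_imp_unit[OF assms, of "()"] by (auto simp: Units_def ring_mat_def)

text \<open>
  A subspace has an adapted basis: among the invertible matrices whose first \<open>k\<close> columns lie in
  \<open>W\<close>, take one with \<open>k\<close> maximal. A vector of \<open>W\<close> outside the span of these columns could be
  exchanged for a later column.
\<close>

lemma adapted_basis:
  fixes W :: "complex vec set"
  assumes W: "W \<subseteq> carrier_vec n"
  obtains P k where "P \<in> carrier_mat n n" "det P \<noteq> 0" "k \<le> n" "\<And>j. j < k \<Longrightarrow> col P j \<in> W"
    "\<And>x l. x \<in> carrier_vec n \<Longrightarrow> P *\<^sub>v x \<in> W \<Longrightarrow> k \<le> l \<Longrightarrow> l < n \<Longrightarrow> x $ l = 0"
proof -
  define good where "good P k \<longleftrightarrow> P \<in> carrier_mat n n \<and> det P \<noteq> 0 \<and> k \<le> n \<and> (\<forall>j<k. col P j \<in> W)"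
    for P :: "complex mat" and k
  have 0: "\<exists>P. good P 0" by (rule exI[of _ "1\<^sub>m n"]) (simp add: good_def)
  define k where "k = (GREATEST k. \<exists>P. good P k)"
  have bd: "\<And>k. \<exists>P. good P k \<Longrightarrow> k \<le> n" by (auto simp: good_def)
  have "\<exists>P. good P k" unfolding k_def by (rule GreatestI_nat[where P = "\<lambda>k. \<exists>P. good P k", OF 0 bd])
  then obtain P where P: "good P k" by blast
  have max: "\<not> good Q (Suc k)" for Q
    using Greatest_le_nat[of "\<lambda>k. \<exists>P. good P k" "Suc k" n] bd unfolding k_def by fastforce
  have "x $ l = 0" if x: "x \<in> carrier_vec n" "P *\<^sub>v x \<in> W" and l: "k \<le> l" "l < n" for x l
  proof (rule ccontr)
    assume nz: "x $ l \<noteq> 0"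
    define R where "R = replace_col P (P *\<^sub>v x) l"
    have PC: "P \<in> carrier_mat n n" using P by (simp add: good_def)
    have R: "R \<in> carrier_mat n n" using PC by (auto simp: R_def replace_col_def)
    \<comment> \<open>By Cramer's rule \<open>det R = x $ l * det P\<close>.\<close>
    have dR: "det R \<noteq> 0"
      unfolding R_def using cramer_lemma_mat[OF PC x(1) l(2)] nz P by (simp add: good_def)
    \<comment> \<open>The vector of \<open>W\<close> is moved to position \<open>k\<close>. Swapping
      two distinct columns only changes the sign of the determinant, so the case
      \<open>k = l\<close> is kept apart.\<close>
    define S where "S = (if k = l then R else swapcols k l R)"
    have S: "S \<in> carrier_mat n n" using R by (auto simp: S_def)
    have "det S \<noteq> 0"
      using dR det_swapcols[OF _ l(2) _ R, of k] l by (auto simp: S_def)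
    moreover have "col S j \<in> W" if j: "j < Suc k" for j
    proof (cases "j = k")
      case True
      have "col S j = P *\<^sub>v x"
        using True l PC by (intro eq_vecI) (auto simp: S_def R_def mat_swapcols_def replace_col_def)
      with x show ?thesis by simp
    next
      case False
      with j have "col S j = col P j"
        using l PC by (intro eq_vecI) (auto simp: S_def R_def mat_swapcols_def replace_col_def)
      with False j P show ?thesis by (simp add: good_def)
    qed
    ultimately have "good S (Suc k)" using S l by (auto simp: good_def)
    with max show False by blast
  qed
  with that P show thesis unfolding good_def by blast
qed

section \<open>Triangular matrices and matrices of finite order\<close>

lemma diag_mult_upper_triangular:
  assumes A: "A \<in> carrier_mat n n" and B: "B \<in> carrier_mat n n"
    and "upper_triangular A" "upper_triangular B" "i < n"
  shows "(A * B) $$ (i, i) = A $$ (i, i) * (B $$ (i, i) :: complex)"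
proof -
  have "(A * B) $$ (i, i) = (\<Sum>l<n. A $$ (i, l) * B $$ (l, i))"
    using index_mult_mat_sum[OF A B] assms by simp
  also have "\<dots> = (\<Sum>l<n. if l = i then A $$ (i, i) * B $$ (i, i) else 0)"
  proof (rule sum.cong[OF refl])
    fix l assume "l \<in> {..<n}"
    then show "A $$ (i, l) * B $$ (l, i) = (if l = i then A $$ (i, i) * B $$ (i, i) else 0)"
      using assms upper_triangularD[of A l i] upper_triangularD[of B i l]
      by (cases l i rule: linorder_cases) auto
  qed
  also have "\<dots> = A $$ (i, i) * B $$ (i, i)" using assms by simp
  finally show ?thesis .
qed

lemma upper_triangular_mult:
  assumes A: "A \<in> carrier_mat n n" and B: "B \<in> carrier_mat n n"
    and "upper_triangular A" "upper_triangular (B :: complex mat)"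
  shows "upper_triangular (A * B)"
proof (rule upper_triangularI)
  fix i j assume ij: "j < i" "i < dim_row (A * B)"
  then have "(A * B) $$ (i, j) = (\<Sum>l<n. A $$ (i, l) * B $$ (l, j))"
    using index_mult_mat_sum[OF A B] A by simp
  also have "\<dots> = 0"
  proof (rule sum.neutral, rule ballI)
    fix l assume "l \<in> {..<n}"
    then show "A $$ (i, l) * B $$ (l, j) = 0"
      using assms ij upper_triangularD[of A l i] upper_triangularD[of B j l]
      by (cases "l < i") auto
  qed
  finally show "(A * B) $$ (i, j) = 0" .
qed

lemma upper_triangular_pow:
  assumes A: "A \<in> carrier_mat n n" and "upper_triangular (A :: complex mat)"
  shows "upper_triangular (A ^\<^sub>m k)" "i < n \<Longrightarrow> (A ^\<^sub>m k) $$ (i, i) = (A $$ (i, i)) ^ k"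
proof (induction k)
  case 0
  {
    case 1 show ?case using A by auto
  next
    case 2 then show ?case using A by simp
  }
next
  case (Suc k)
  {
    case 1 show ?case using upper_triangular_mult[OF _ A Suc(1) assms(2)] A by (simp add: pow_carrier_mat)
  next
    case 2 then show ?case
      using diag_mult_upper_triangular[OF _ A Suc(1) assms(2)] Suc(2) A by (simp add: pow_carrier_mat)
  }
qed

text \<open>No real part exceeds 1, so the value of the sum forces every real part to be 1; the norm
  then leaves no room for an imaginary part.\<close>

lemma norm_one_sum_eq_card:
  fixes f :: "nat \<Rightarrow> complex"
  assumes "\<And>i. i < n \<Longrightarrow> norm (f i) = 1" "(\<Sum>i<n. f i) = of_nat n" "i < n"
  shows "f i = 1"
proof -
  have "(\<Sum>i<n. 1 - Re (f i)) = 0"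
    using arg_cong[OF assms(2), of Re] by (simp add: sum_subtractf)
  moreover have "\<And>i. i < n \<Longrightarrow> 0 \<le> 1 - Re (f i)"
    using assms(1) complex_Re_le_cmod by (metis diff_ge_0_iff_ge)
  ultimately have "1 - Re (f i) = 0"
    using assms(3) by (subst (asm) sum_nonneg_eq_0_iff) auto
  moreover have "(Re (f i))\<^sup>2 + (Im (f i))\<^sup>2 = 1"
    using assms(1)[OF assms(3)] by (simp add: cmod_def)
  ultimately show ?thesis by (simp add: complex_eq_iff)
qed

text \<open>
  In triangular form \<open>U\<close> has diagonal entries \<open>1\<close>, so in
  \<open>0 = 1 - U\<^sup>k = (1 - U) (1 + U + \<dots> + U\<^sup>k\<^sup>-\<^sup>1)\<close> the last factor is triangular with diagonal
  entries \<open>k\<close>, hence invertible.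
\<close>

lemma finite_order_mtrace_eq_dim:
  assumes M: "M \<in> carrier_mat n n" and k: "k > 0" "M ^\<^sub>m k = 1\<^sub>m n" and tr: "mtrace M = of_nat n"
  shows "M = 1\<^sub>m n"
proof -
  obtain es where es: "char_poly M = (\<Prod>a\<leftarrow>es. [:- a, 1:])"
    using char_poly_factorized[OF M] by blast
  obtain U where U: "U \<in> carrier_mat n n" "upper_triangular U" "similar_mat M U"
    using schur_decomposition_exists[OF M es] by blast
  then obtain P Q where PQ: "similar_mat_wit M U P Q" unfolding similar_mat_def by blast
  note wit = similar_mat_witD2[OF M PQ]
  have Uk: "U ^\<^sub>m k = 1\<^sub>m n"
  proof -
    have "similar_mat_wit U M Q P" using PQ by (rule similar_mat_wit_sym)
    from similar_mat_wit_pow[OF this, of k] k(2)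
    have "similar_mat_wit (U ^\<^sub>m k) (1\<^sub>m n) Q P" by simp
    note w = similar_mat_witD2[OF pow_carrier_mat[OF U(1)] this]
    show ?thesis unfolding w(3) right_mult_one_mat[OF w(6)] by (rule w(1))
  qed
  note [simp] = wit(5,6,7) and assoc = assoc_mult_mat[of _ n n _ n _ n]
  have "mtrace M = mtrace (P * (U * Q))" by (subst wit(3)) (simp add: assoc)
  also have "\<dots> = mtrace (U * Q * P)" by (rule mtrace_mult_comm[OF wit(6) mult_carrier_mat[OF wit(5,7)]])
  also have "U * Q * P = U" by (simp add: assoc wit(2) right_mult_one_mat[OF wit(5)])
  finally have "mtrace M = mtrace U" .
  then have sum: "(\<Sum>i<n. U $$ (i, i)) = of_nat n" using tr U by (simp add: mtrace_def)
  \<comment> \<open>The diagonal entries are \<open>k\<close>-th roots of unity whose sum is the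
    trace \<open>n\<close>, so \<open>norm_one_sum_eq_card\<close> makes each of them 1.\<close>
  have root: "(U $$ (i, i)) ^ k = 1" if "i < n" for i
    using upper_triangular_pow(2)[OF U(1,2) that, of k] that Uk by simp
  have nrm: "norm (U $$ (i, i)) = 1" if "i < n" for i
    using power_eq_imp_eq_base[of "norm (U $$ (i, i))" k 1] arg_cong[OF root[OF that], of norm] k(1)
    by (simp add: norm_power)
  have diag: "U $$ (i, i) = 1" if "i < n" for i
    using norm_one_sum_eq_card[OF nrm sum that] by simp
  define S where "S = msum n n (\<lambda>j. U ^\<^sub>m j) {..<k}"
  have S: "S \<in> carrier_mat n n" by (simp add: S_def)
  have "S * U = msum n n (\<lambda>j. U ^\<^sub>m Suc j) {..<k}"
    unfolding S_def pow_mat.simps by (rule msum_mult[OF U(1)]) (simp add: pow_carrier_mat)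
  also have "\<dots> = S"
  proof (rule eq_matI)
    fix i j assume "i < dim_row S" "j < dim_col S"
    then have ij: "i < n" "j < n" using S by auto
    \<comment> \<open>The shifted sum loses the zeroth power and gains the \<open>k\<close>-th one,
      and both are the identity.\<close>
    have "(\<Sum>l<k. (U ^\<^sub>m Suc l) $$ (i, j)) = (\<Sum>l<k. (U ^\<^sub>m l) $$ (i, j))"
      using sum.lessThan_Suc_shift[of "\<lambda>l. (U ^\<^sub>m l) $$ (i, j)" k]
        sum.lessThan_Suc[of "\<lambda>l. (U ^\<^sub>m l) $$ (i, j)" k] Uk U(1)
      by (simp del: sum.lessThan_Suc pow_mat.simps(2))
    then show "msum n n (\<lambda>j. U ^\<^sub>m Suc j) {..<k} $$ (i, j) = S $$ (i, j)"
      using ij by (simp add: S_def del: pow_mat.simps(2))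
  qed (auto simp: S_def)
  finally have SU: "S * U = S" .
  have "upper_triangular S"
    using upper_triangularD[OF upper_triangular_pow(1)[OF U(1,2)]] U(1)
    by (intro upper_triangularI) (auto simp: S_def intro!: sum.neutral)
  then have "det S = prod_list (diag_mat S)" using S by (rule det_upper_triangular)
  moreover have "S $$ (i, i) = of_nat k" if "i < n" for i
    using that upper_triangular_pow(2)[OF U(1,2) that] diag[OF that] by (simp add: S_def)
  ultimately have "det S \<noteq> 0"
    using S k by (auto simp: diag_mat_def prod_list_zero_iff)
  then obtain T where T: "T \<in> carrier_mat n n" "T * S = 1\<^sub>m n"
    using det_nonzero_obtain_inverse[OF S] by blast
  have "U = T * S * U" unfolding T(2) left_mult_one_mat[OF U(1)] ..
  also have "\<dots> = T * (S * U)" using S T(1) by (simp add: assoc)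
  finally have "U = 1\<^sub>m n" unfolding SU T(2) .
  then show ?thesis by (subst wit(3)) (simp only: right_mult_one_mat[OF wit(6)] wit(1))
qed

section \<open>Representations and direct sums\<close>

locale finite_group = group G for G :: "('g, 'b) monoid_scheme" (structure) +
  assumes finite_carrier [simp]: "finite (carrier G)"

text \<open>Invertibility of the values is left implicit: the inverse of \<open>\<rho> g\<close> is
  \<open>\<rho> (inv g)\<close>. The degree is a parameter so that dimensions are at hand in matrix
  computations.\<close>

definition (in finite_group) is_rep :: "nat \<Rightarrow> ('g \<Rightarrow> complex mat) \<Rightarrow> bool" where
  "is_rep n \<rho> \<longleftrightarrow> (\<forall>g \<in> carrier G. \<rho> g \<in> carrier_mat n n) \<and> \<rho> \<one> = 1\<^sub>m n \<and>
     (\<forall>g \<in> carrier G. \<forall>h \<in> carrier G. \<rho> (g \<otimes> h) = \<rho> g * \<rho> h)"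

definition dsum2 :: "('g \<Rightarrow> complex mat) \<Rightarrow> ('g \<Rightarrow> complex mat) \<Rightarrow> 'g \<Rightarrow> complex mat" where
  "dsum2 \<alpha> \<beta> g = (let A = \<alpha> g; B = \<beta> g in
     four_block_mat A (0\<^sub>m (dim_row A) (dim_col B)) (0\<^sub>m (dim_row B) (dim_col A)) B)"

lemma direct_sum_rep_Nil [simp]: "direct_sum_rep [] = (\<lambda>g. 0\<^sub>m 0 0)"
  by (simp add: direct_sum_rep_def)

lemma direct_sum_rep_Cons: "direct_sum_rep (\<tau> # \<tau>s) = dsum2 \<tau> (direct_sum_rep \<tau>s)"
  by (simp add: direct_sum_rep_def dsum2_def Let_def fun_eq_iff)

lemma direct_sum_rep_append:
  "direct_sum_rep (\<tau>s @ \<tau>s') = dsum2 (direct_sum_rep \<tau>s) (direct_sum_rep \<tau>s')"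
  by (simp add: direct_sum_rep_def dsum2_def Let_def fun_eq_iff diag_block_mat_append)

lemma direct_sum_rep_singleton: "direct_sum_rep [\<tau>] = \<tau>"
  by (simp add: direct_sum_rep_def del: diag_block_mat.simps)

context finite_group
begin

lemma is_repD:
  assumes "is_rep n \<rho>"
  shows "g \<in> carrier G \<Longrightarrow> \<rho> g \<in> carrier_mat n n" "\<rho> \<one> = 1\<^sub>m n"
    "g \<in> carrier G \<Longrightarrow> h \<in> carrier G \<Longrightarrow> \<rho> (g \<otimes> h) = \<rho> g * \<rho> h"
  using assms by (auto simp: is_rep_def)

lemma is_rep_inv:
  assumes "is_rep n \<rho>" "g \<in> carrier G"
  shows "\<rho> g * \<rho> (inv g) = 1\<^sub>m n" "\<rho> (inv g) * \<rho> g = 1\<^sub>m n"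
  using is_repD[OF assms(1)] assms(2) by (metis inv_closed r_inv, metis inv_closed l_inv)

lemma is_rep_degree:
  assumes "is_rep n \<rho>" shows "rep_degree G \<rho> = n"
  using assms by (simp add: is_rep_def rep_degree_def)

text \<open>Membership in \<open>hom\<close> says nothing about the unit, but the image of the unit
  is an idempotent with a left inverse, hence the identity matrix.\<close>

lemma representation_iff_is_rep: "representation G \<rho> \<longleftrightarrow> is_rep (rep_degree G \<rho>) \<rho>"
proof
  assume "representation G \<rho>"
  then have hom: "\<rho> \<in> hom G (GL (rep_degree G \<rho>))" by (simp add: representation_def)
  let ?n = "rep_degree G \<rho>"
  have car: "\<rho> g \<in> carrier_mat ?n ?n" if "g \<in> carrier G" for g
    using hom that by (auto simp: hom_def GL_def units_of_def Units_def ring_mat_def)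
  have mult: "\<rho> (g \<otimes> h) = \<rho> g * \<rho> h" if "g \<in> carrier G" "h \<in> carrier G" for g h
    using hom that by (auto simp: hom_def GL_def units_of_def ring_mat_def)
  have "\<rho> \<one> \<in> carrier (GL ?n)" using hom by (auto simp: hom_def)
  then obtain B where B: "B \<in> carrier_mat ?n ?n" "B * \<rho> \<one> = 1\<^sub>m ?n"
    by (auto simp: GL_def units_of_def Units_def ring_mat_def)
  have "\<rho> \<one> = B * \<rho> \<one> * \<rho> \<one>" using B car[OF one_closed] by simp
  also have "\<dots> = B * (\<rho> \<one> * \<rho> \<one>)"
    by (rule assoc_mult_mat[OF B(1) car[OF one_closed] car[OF one_closed]])
  also have "\<rho> \<one> * \<rho> \<one> = \<rho> \<one>" using mult[of \<one> \<one>] by simp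
  finally show "is_rep ?n \<rho>" using B car mult by (simp add: is_rep_def)
next
  let ?n = "rep_degree G \<rho>"
  assume r: "is_rep ?n \<rho>"
  have "\<rho> g \<in> Units (ring_mat TYPE(complex) ?n ())" if "g \<in> carrier G" for g
    using is_rep_inv[OF r that] is_repD(1)[OF r that] is_repD(1)[OF r inv_closed[OF that]]
    by (auto simp: Units_def ring_mat_def)
  then show "representation G \<rho>"
    using is_repD(3)[OF r]
    by (auto simp: representation_def hom_def GL_def units_of_def ring_mat_def)
qed

text \<open>Two-sided inverses of rectangular shape are easier to compose than
  \<open>invertible_mat\<close>; that the degrees agree is recovered from the trace.\<close>

lemma rep_iso_iff:
  assumes "is_rep m \<rho>" "is_rep n \<sigma>"
  shows "rep_iso G \<rho> \<sigma> \<longleftrightarrow> (\<exists>P Q. P \<in> carrier_mat n m \<and> Q \<in> carrier_mat m n \<and>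
    P * Q = 1\<^sub>m n \<and> Q * P = 1\<^sub>m m \<and> (\<forall>g \<in> carrier G. P * \<rho> g = \<sigma> g * P))"
    (is "_ \<longleftrightarrow> (\<exists>P Q. ?C P Q)")
proof
  assume "rep_iso G \<rho> \<sigma>"
  then obtain P Q where P: "P \<in> carrier_mat n m" "square_mat P" "inverts_mat P Q" "inverts_mat Q P"
    "\<forall>g \<in> carrier G. P * \<rho> g = \<sigma> g * P"
    using is_rep_degree[OF assms(1)] is_rep_degree[OF assms(2)]
    unfolding rep_iso_def invertible_mat_def by auto
  then have PQ: "P * Q = 1\<^sub>m n" "Q * P = 1\<^sub>m (dim_row Q)" by (auto simp: inverts_mat_def)
  have "dim_col Q = n" using arg_cong[OF PQ(1), of dim_col] by simp
  moreover have "dim_row Q = m" using arg_cong[OF PQ(2), of dim_col] P by simp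
  ultimately have "?C P Q" using P PQ by auto
  then show "\<exists>P Q. ?C P Q" by blast
next
  assume "\<exists>P Q. ?C P Q"
  then obtain P Q where C: "?C P Q" by blast
  then have "m = n" using inverse_imp_same_size[of P n m Q] by simp
  with C have "invertible_mat P" unfolding invertible_mat_def inverts_mat_def by auto
  with C show "rep_iso G \<rho> \<sigma>"
    using is_rep_degree[OF assms(1)] is_rep_degree[OF assms(2)] unfolding rep_iso_def by auto
qed

lemma rep_iso_refl [simp]:
  assumes "is_rep n \<rho>" shows "rep_iso G \<rho> \<rho>"
  unfolding rep_iso_iff[OF assms assms]
  by (rule exI[of _ "1\<^sub>m n"], rule exI[of _ "1\<^sub>m n"]) (use is_repD(1)[OF assms] left_mult_one_mat[OF is_repD(1)[OF assms]] right_mult_one_mat[OF is_repD(1)[OF assms]] in auto)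

lemma rep_iso_sym:
  assumes \<rho>: "is_rep m \<rho>" and \<sigma>: "is_rep n \<sigma>" and "rep_iso G \<rho> \<sigma>"
  shows "rep_iso G \<sigma> \<rho>"
proof -
  obtain P Q where P: "P \<in> carrier_mat n m" "Q \<in> carrier_mat m n"
    "P * Q = 1\<^sub>m n" "Q * P = 1\<^sub>m m" "\<And>g. g \<in> carrier G \<Longrightarrow> P * \<rho> g = \<sigma> g * P"
    using assms(3) unfolding rep_iso_iff[OF assms(1,2)] by blast
  have "Q * \<sigma> g = \<rho> g * Q" if g: "g \<in> carrier G" for g
  proof -
    note c = is_repD(1)[OF \<rho> g] is_repD(1)[OF \<sigma> g]
    have "Q * \<sigma> g = Q * (\<sigma> g * (P * Q))" using P c by simp
    also have "\<dots> = Q * (\<sigma> g * P * Q)"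
      using assoc_mult_mat[OF c(2) P(1,2)] by simp
    also have "\<dots> = Q * (P * \<rho> g * Q)" using P(5)[OF g] by simp
    also have "\<dots> = Q * (P * (\<rho> g * Q))" using assoc_mult_mat[OF P(1) c(1) P(2)] by simp
    also have "\<dots> = Q * P * (\<rho> g * Q)"
      using assoc_mult_mat[OF P(2,1) mult_carrier_mat[OF c(1) P(2)]] by simp
    also have "\<dots> = \<rho> g * Q" using P c by simp
    finally show ?thesis .
  qed
  with P show ?thesis unfolding rep_iso_iff[OF \<sigma> \<rho>] by blast
qed

lemma rep_iso_trans:
  assumes \<rho>: "is_rep m \<rho>" and \<sigma>: "is_rep n \<sigma>" and \<tau>: "is_rep k \<tau>"
    and "rep_iso G \<rho> \<sigma>" "rep_iso G \<sigma> \<tau>"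
  shows "rep_iso G \<rho> \<tau>"
proof -
  obtain P Q where P: "P \<in> carrier_mat n m" "Q \<in> carrier_mat m n"
    "P * Q = 1\<^sub>m n" "Q * P = 1\<^sub>m m" "\<And>g. g \<in> carrier G \<Longrightarrow> P * \<rho> g = \<sigma> g * P"
    using assms(4) unfolding rep_iso_iff[OF \<rho> \<sigma>] by blast
  obtain P' Q' where P': "P' \<in> carrier_mat k n" "Q' \<in> carrier_mat n k"
    "P' * Q' = 1\<^sub>m k" "Q' * P' = 1\<^sub>m n" "\<And>g. g \<in> carrier G \<Longrightarrow> P' * \<sigma> g = \<tau> g * P'"
    using assms(5) unfolding rep_iso_iff[OF \<sigma> \<tau>] by blast
  have "P' * P * (Q * Q') = P' * (P * (Q * Q'))"
    by (rule assoc_mult_mat[OF P'(1) P(1) mult_carrier_mat[OF P(2) P'(2)]])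
  also have "P * (Q * Q') = Q'" using assoc_mult_mat[OF P(1,2) P'(2)] P P' by simp
  finally have 1: "P' * P * (Q * Q') = 1\<^sub>m k" using P' by simp
  have "Q * Q' * (P' * P) = Q * (Q' * (P' * P))"
    by (rule assoc_mult_mat[OF P(2) P'(2) mult_carrier_mat[OF P'(1) P(1)]])
  also have "Q' * (P' * P) = P" using assoc_mult_mat[OF P'(2,1) P(1)] P P' by simp
  finally have 2: "Q * Q' * (P' * P) = 1\<^sub>m m" using P by simp
  have 3: "P' * P * \<rho> g = \<tau> g * (P' * P)" if g: "g \<in> carrier G" for g
  proof -
    note c = is_repD(1)[OF \<rho> g] is_repD(1)[OF \<sigma> g] is_repD(1)[OF \<tau> g]
    show ?thesis using assoc_mult_mat[OF P'(1) P(1) c(1)] assoc_mult_mat[OF P'(1) c(2) P(1)]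
      assoc_mult_mat[OF c(3) P'(1) P(1)] P(5)[OF g] P'(5)[OF g] by simp
  qed
  show ?thesis unfolding rep_iso_iff[OF \<rho> \<tau>]
    by (rule exI[of _ "P' * P"], rule exI[of _ "Q * Q'"])
      (use 1 2 3 mult_carrier_mat[OF P'(1) P(1)] mult_carrier_mat[OF P(2) P'(2)] in blast)
qed

section \<open>Direct sums of representations\<close>

lemma dsum2_eq:
  assumes "is_rep m \<alpha>" "is_rep n \<beta>" "g \<in> carrier G"
  shows "dsum2 \<alpha> \<beta> g = four_block_mat (\<alpha> g) (0\<^sub>m m n) (0\<^sub>m n m) (\<beta> g)"
  using is_repD(1)[OF assms(1,3)] is_repD(1)[OF assms(2,3)] by (simp add: dsum2_def)

lemma is_rep_dsum2:
  assumes "is_rep m \<alpha>" "is_rep n \<beta>"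
  shows "is_rep (m + n) (dsum2 \<alpha> \<beta>)"
  unfolding is_rep_def
proof (intro conjI ballI)
  fix g assume g: "g \<in> carrier G"
  show "dsum2 \<alpha> \<beta> g \<in> carrier_mat (m + n) (m + n)"
    using is_repD(1)[OF assms(1) g] is_repD(1)[OF assms(2) g] by (simp add: dsum2_eq[OF assms g])
  fix h assume h: "h \<in> carrier G"
  note c = is_repD(1)[OF assms(1) g] is_repD(1)[OF assms(2) g]
    is_repD(1)[OF assms(1) h] is_repD(1)[OF assms(2) h]
  show "dsum2 \<alpha> \<beta> (g \<otimes> h) = dsum2 \<alpha> \<beta> g * dsum2 \<alpha> \<beta> h"
    unfolding dsum2_eq[OF assms g] dsum2_eq[OF assms h] dsum2_eq[OF assms m_closed[OF g h]]
      mult_four_block_mat[OF c(1) zero_carrier_mat zero_carrier_mat c(2)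
        c(3) zero_carrier_mat zero_carrier_mat c(4)]
    using c mult_carrier_mat[OF c(1,3)] mult_carrier_mat[OF c(2,4)]
    by (simp add: is_repD(3)[OF assms(1) g h] is_repD(3)[OF assms(2) g h])
next
  show "dsum2 \<alpha> \<beta> \<one> = 1\<^sub>m (m + n)"
    using is_repD(2)[OF assms(1)] is_repD(2)[OF assms(2)] by (simp add: dsum2_eq[OF assms])
qed

lemma rep_iso_dsum2_cong:
  assumes a: "is_rep m \<alpha>" "is_rep m' \<alpha>'" and b: "is_rep n \<beta>" "is_rep n' \<beta>'"
    and "rep_iso G \<alpha> \<alpha>'" "rep_iso G \<beta> \<beta>'"
  shows "rep_iso G (dsum2 \<alpha> \<beta>) (dsum2 \<alpha>' \<beta>')"
proof -
  obtain P Q where P: "P \<in> carrier_mat m' m" "Q \<in> carrier_mat m m'"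
    "P * Q = 1\<^sub>m m'" "Q * P = 1\<^sub>m m" "\<And>g. g \<in> carrier G \<Longrightarrow> P * \<alpha> g = \<alpha>' g * P"
    using assms(5) unfolding rep_iso_iff[OF a] by blast
  obtain P' Q' where P': "P' \<in> carrier_mat n' n" "Q' \<in> carrier_mat n n'"
    "P' * Q' = 1\<^sub>m n'" "Q' * P' = 1\<^sub>m n" "\<And>g. g \<in> carrier G \<Longrightarrow> P' * \<beta> g = \<beta>' g * P'"
    using assms(6) unfolding rep_iso_iff[OF b] by blast
  let ?P = "four_block_mat P (0\<^sub>m m' n) (0\<^sub>m n' m) P'"
  let ?Q = "four_block_mat Q (0\<^sub>m m n') (0\<^sub>m n m') Q'"
  note z = zero_carrier_mat
  have 1: "?P * ?Q = 1\<^sub>m (m' + n')"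
    unfolding mult_four_block_mat[OF P(1) z z P'(1) P(2) z z P'(2)] using P P' by simp
  have 2: "?Q * ?P = 1\<^sub>m (m + n)"
    unfolding mult_four_block_mat[OF P(2) z z P'(2) P(1) z z P'(1)] using P P' by simp
  have 3: "?P * dsum2 \<alpha> \<beta> g = dsum2 \<alpha>' \<beta>' g * ?P" if g: "g \<in> carrier G" for g
  proof -
    note c = is_repD(1)[OF a(1) g] is_repD(1)[OF b(1) g]
      is_repD(1)[OF a(2) g] is_repD(1)[OF b(2) g]
    show ?thesis
      unfolding dsum2_eq[OF a(1) b(1) g] dsum2_eq[OF a(2) b(2) g]
        mult_four_block_mat[OF P(1) z z P'(1) c(1) z z c(2)]
        mult_four_block_mat[OF c(3) z z c(4) P(1) z z P'(1)]
      using P(1,5) P'(1,5) c g mult_carrier_mat[OF c(3) P(1)] mult_carrier_mat[OF c(4) P'(1)] by simp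
  qed
  have "?P \<in> carrier_mat (m' + n') (m + n)" "?Q \<in> carrier_mat (m + n) (m' + n')"
    using P P' by auto
  with 1 2 3 show ?thesis
    unfolding rep_iso_iff[OF is_rep_dsum2[OF a(1) b(1)] is_rep_dsum2[OF a(2) b(2)]] by blast
qed

lemma rep_iso_dsum2_swap:
  assumes a: "is_rep m \<alpha>" and b: "is_rep n \<beta>"
  shows "rep_iso G (dsum2 \<alpha> \<beta>) (dsum2 \<beta> \<alpha>)"
proof -
  let ?P = "four_block_mat (0\<^sub>m n m :: complex mat) (1\<^sub>m n) (1\<^sub>m m) (0\<^sub>m m n)"
  let ?Q = "four_block_mat (0\<^sub>m m n :: complex mat) (1\<^sub>m m) (1\<^sub>m n) (0\<^sub>m n m)"
  note z = zero_carrier_mat and o = one_carrier_mat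
  have 1: "?P * ?Q = 1\<^sub>m (n + m)"
    unfolding mult_four_block_mat[OF z o o z z o o z] by simp
  have 2: "?Q * ?P = 1\<^sub>m (m + n)"
    unfolding mult_four_block_mat[OF z o o z z o o z] by simp
  have 3: "?P * dsum2 \<alpha> \<beta> g = dsum2 \<beta> \<alpha> g * ?P" if g: "g \<in> carrier G" for g
  proof -
    note c = is_repD(1)[OF a(1) g] is_repD(1)[OF b(1) g]
    show ?thesis
      unfolding dsum2_eq[OF a b g] dsum2_eq[OF b a g]
        mult_four_block_mat[OF z o o z c(1) z z c(2)]
        mult_four_block_mat[OF c(2) z z c(1) z o o z]
      using c by simp
  qed
  have "?P \<in> carrier_mat (n + m) (m + n)" "?Q \<in> carrier_mat (m + n) (n + m)"
    by (auto simp: add.commute)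
  with 1 2 3 show ?thesis
    unfolding rep_iso_iff[OF is_rep_dsum2[OF a b] is_rep_dsum2[OF b a]] by blast
qed

text \<open>Associativity is an equality, not merely an isomorphism: both sides are the block
  diagonal matrix of the list of the three blocks.\<close>

lemma dsum2_assoc: "dsum2 (dsum2 \<alpha> \<beta>) \<gamma> = dsum2 \<alpha> (dsum2 \<beta> \<gamma>)"
  using direct_sum_rep_append[of "[\<alpha>, \<beta>]" "[\<gamma>]"]
  by (simp add: direct_sum_rep_singleton direct_sum_rep_Cons[of _ "_ # _"])

lemma is_rep_zero: "is_rep 0 (\<lambda>g. 0\<^sub>m 0 0)"
  by (auto simp: is_rep_def)

lemma is_rep_imp_representation: "is_rep n \<rho> \<Longrightarrow> representation G \<rho>"
  using is_rep_degree representation_iff_is_rep by metis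

lemma representation_direct_sum:
  assumes "\<forall>\<tau> \<in> set \<tau>s. representation G \<tau>"
  shows "representation G (direct_sum_rep \<tau>s)"
  using assms
proof (induction \<tau>s)
  case Nil
  show ?case using is_rep_imp_representation[OF is_rep_zero] by simp
next
  case (Cons \<tau> \<tau>s)
  then obtain m n where "is_rep m \<tau>" "is_rep n (direct_sum_rep \<tau>s)"
    by (auto simp: representation_iff_is_rep)
  from is_rep_imp_representation[OF is_rep_dsum2[OF this]] show ?case
    by (simp add: direct_sum_rep_Cons)
qed

lemma rep_iso_refl' [simp]: "representation G \<rho> \<Longrightarrow> rep_iso G \<rho> \<rho>"
  using rep_iso_refl representation_iff_is_rep by blast

lemma rep_iso_trans':
  "representation G \<rho> \<Longrightarrow> representation G \<sigma> \<Longrightarrow> representation G \<tau> \<Longrightarrow>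
    rep_iso G \<rho> \<sigma> \<Longrightarrow> rep_iso G \<sigma> \<tau> \<Longrightarrow> rep_iso G \<rho> \<tau>"
  using rep_iso_trans representation_iff_is_rep by blast

lemma representation_dsum2:
  "representation G \<alpha> \<Longrightarrow> representation G \<beta> \<Longrightarrow> representation G (dsum2 \<alpha> \<beta>)"
  using is_rep_dsum2 is_rep_imp_representation representation_iff_is_rep by metis

lemma rep_iso_dsum2_cong':
  "representation G \<alpha> \<Longrightarrow> representation G \<alpha>' \<Longrightarrow> representation G \<beta> \<Longrightarrow> representation G \<beta>' \<Longrightarrow>
    rep_iso G \<alpha> \<alpha>' \<Longrightarrow> rep_iso G \<beta> \<beta>' \<Longrightarrow> rep_iso G (dsum2 \<alpha> \<beta>) (dsum2 \<alpha>' \<beta>')"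
  using rep_iso_dsum2_cong representation_iff_is_rep by blast

lemma rep_iso_dsum2_swap':
  "representation G \<alpha> \<Longrightarrow> representation G \<beta> \<Longrightarrow> rep_iso G (dsum2 \<alpha> \<beta>) (dsum2 \<beta> \<alpha>)"
  using rep_iso_dsum2_swap representation_iff_is_rep by blast

lemma rep_iso_direct_sum_cong:
  assumes "list_all2 (\<lambda>\<tau> \<tau>'. representation G \<tau> \<and> representation G \<tau>' \<and> rep_iso G \<tau> \<tau>') \<tau>s \<tau>s'"
  shows "rep_iso G (direct_sum_rep \<tau>s) (direct_sum_rep \<tau>s')"
  using assms
proof (induction rule: list_all2_induct)
  case Nil
  show ?case using rep_iso_refl[OF is_rep_zero] by simp
next
  case (Cons \<tau> \<tau>s \<tau>' \<tau>s')
  then have "\<forall>\<tau> \<in> set \<tau>s. representation G \<tau>" "\<forall>\<tau> \<in> set \<tau>s'. representation G \<tau>"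
    by (auto simp: list_all2_conv_all_nth set_conv_nth)
  with Cons show ?case
    by (auto simp: direct_sum_rep_Cons intro!: rep_iso_dsum2_cong' representation_direct_sum)
qed

text \<open>The head of the first list is carried past the segment \<open>us\<close> of the second
  list by a single block swap; induction rearranges the rest. This permits sorting irreducible
  summands by type.\<close>

lemma rep_iso_direct_sum_mset:
  assumes "mset \<tau>s = mset \<tau>s'" "\<forall>\<tau> \<in> set \<tau>s. representation G \<tau>"
  shows "rep_iso G (direct_sum_rep \<tau>s) (direct_sum_rep \<tau>s')"
  using assms
proof (induction \<tau>s arbitrary: \<tau>s')
  case Nil
  then show ?case using rep_iso_refl[OF is_rep_zero] by simp
next
  case (Cons \<tau> \<tau>s)
  then have "\<tau> \<in> set \<tau>s'" by (metis list.set_intros(1) mset_eq_setD)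
  then obtain us vs where \<tau>s': "\<tau>s' = us @ \<tau> # vs" by (meson split_list)
  then have ms: "mset \<tau>s = mset (us @ vs)" using Cons.prems by simp
  have "set \<tau>s = set us \<union> set vs" using mset_eq_setD[OF ms] by simp
  then have r: "representation G \<tau>" "\<forall>\<tau> \<in> set \<tau>s. representation G \<tau>"
      "representation G (direct_sum_rep us)" "representation G (direct_sum_rep vs)"
      "representation G (direct_sum_rep \<tau>s)"
    using Cons.prems by (auto intro!: representation_direct_sum)
  let ?U = "direct_sum_rep us" and ?V = "direct_sum_rep vs"
  have "rep_iso G (direct_sum_rep \<tau>s) (dsum2 ?U ?V)"
    using Cons.IH[OF ms] r by (simp add: direct_sum_rep_append)
  then have "rep_iso G (direct_sum_rep (\<tau> # \<tau>s)) (dsum2 \<tau> (dsum2 ?U ?V))"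
    unfolding direct_sum_rep_Cons using r by (intro rep_iso_dsum2_cong' representation_dsum2) auto
  moreover have "rep_iso G (dsum2 \<tau> (dsum2 ?U ?V)) (dsum2 (dsum2 ?U \<tau>) ?V)"
    unfolding dsum2_assoc[of \<tau> ?U ?V, symmetric] using r
    by (intro rep_iso_dsum2_cong' representation_dsum2 rep_iso_dsum2_swap')  auto
  moreover have "dsum2 (dsum2 ?U \<tau>) ?V = direct_sum_rep \<tau>s'"
    by (simp add: \<tau>s' direct_sum_rep_append direct_sum_rep_Cons dsum2_assoc)
  ultimately show ?case
    using r by (metis (no_types, lifting) rep_iso_trans' representation_dsum2 direct_sum_rep_Cons)
qed

end

section \<open>Complete reducibility\<close>

lemma four_block_mat_inj:
  assumes eq: "four_block_mat A B C D = four_block_mat A' B' C' D'"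
    and c: "A \<in> carrier_mat m p" "B \<in> carrier_mat m q" "C \<in> carrier_mat n p" "D \<in> carrier_mat n q"
    and c': "A' \<in> carrier_mat m p" "B' \<in> carrier_mat m q" "C' \<in> carrier_mat n p" "D' \<in> carrier_mat n q"
  shows "A = A'" "B = B'" "C = C'" "D = D'"
proof -
  let ?L = "four_block_mat A B C D" and ?R = "four_block_mat A' B' C' D'"
  have "A $$ (i, j) = A' $$ (i, j)" if "i < m" "j < p" for i j
    using arg_cong[OF eq, of "\<lambda>M. M $$ (i, j)"] c c' that by simp
  then show "A = A'" using c c' by (intro eq_matI) auto
  have "B $$ (i, j) = B' $$ (i, j)" if "i < m" "j < q" for i j
    using arg_cong[OF eq, of "\<lambda>M. M $$ (i, j + p)"] c c' that by simp
  then show "B = B'" using c c' by (intro eq_matI) auto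
  have "C $$ (i, j) = C' $$ (i, j)" if "i < n" "j < p" for i j
    using arg_cong[OF eq, of "\<lambda>M. M $$ (i + m, j)"] c c' that by simp
  then show "C = C'" using c c' by (intro eq_matI) auto
  have "D $$ (i, j) = D' $$ (i, j)" if "i < n" "j < q" for i j
    using arg_cong[OF eq, of "\<lambda>M. M $$ (i + m, j + p)"] c c' that by simp
  then show "D = D'" using c c' by (intro eq_matI) auto
qed

lemma subspace_closed:
  assumes "VectorSpace.subspace class_ring W (module_vec TYPE(complex) n)"
  shows "W \<subseteq> carrier_vec n" "0\<^sub>v n \<in> W"
    "v \<in> W \<Longrightarrow> w \<in> W \<Longrightarrow> v + w \<in> W" "v \<in> W \<Longrightarrow> c \<cdot>\<^sub>v v \<in> W"
  using assms unfolding VectorSpace.subspace_def LinearCombinations.submodule_def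
  by (auto simp: module_vec_def)

text \<open>The product is a linear combination of the first \<open>k\<close> columns of
  \<open>P\<close>. A subspace is closed under binary sums, so the induction adds one column at a
  time, with \<open>t m\<close> the truncation of \<open>x\<close> to its first \<open>m\<close>
  entries.\<close>

lemma mult_vec_in_subspace:
  fixes P :: "complex mat"
  assumes W: "VectorSpace.subspace class_ring W (module_vec TYPE(complex) n)"
    and P: "P \<in> carrier_mat n n" and cols: "\<And>j. j < k \<Longrightarrow> col P j \<in> W" and k: "k \<le> n"
    and x: "x \<in> carrier_vec n" "\<And>l. k \<le> l \<Longrightarrow> l < n \<Longrightarrow> x $ l = 0"
  shows "P *\<^sub>v x \<in> W"
proof -
  define t where "t m = vec n (\<lambda>l. if l < m then x $ l else 0)" for m
  have "P *\<^sub>v t m \<in> W" if "m \<le> k" for m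
    using that
  proof (induction m)
    case 0
    have "t 0 = 0\<^sub>v n" by (auto simp: t_def)
    moreover have "P *\<^sub>v 0\<^sub>v n = 0\<^sub>v n" using P by (intro eq_vecI) auto
    ultimately show ?case using subspace_closed(2)[OF W] by simp
  next
    case (Suc m)
    then have m: "m < n" "m < k" using k by auto
    have "t (Suc m) = t m + x $ m \<cdot>\<^sub>v unit_vec n m"
      using m by (intro eq_vecI) (auto simp: t_def less_Suc_eq)
    moreover have "P *\<^sub>v (t m + x $ m \<cdot>\<^sub>v unit_vec n m) = P *\<^sub>v t m + x $ m \<cdot>\<^sub>v (P *\<^sub>v unit_vec n m)"
      using P by (simp add: mult_add_distrib_mat_vec[of _ n n] t_def mult_mat_vec[of _ n n])
    moreover have "P *\<^sub>v unit_vec n m = col P m"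
      using P m(1) by (intro eq_vecI) auto
    ultimately show ?case
      using subspace_closed(3,4)[OF W] Suc cols[OF m(2)] by simp
  qed
  moreover have "t k = x" using x k by (intro eq_vecI) (auto simp: t_def)
  ultimately show ?thesis by auto
qed

context finite_group
begin

lemma is_rep_conjugate:
  assumes \<tau>: "is_rep n \<tau>" and PQ: "P \<in> carrier_mat n n" "Q \<in> carrier_mat n n"
    "P * Q = 1\<^sub>m n" "Q * P = 1\<^sub>m n"
  shows "is_rep n (\<lambda>g. Q * \<tau> g * P)" "rep_iso G \<tau> (\<lambda>g. Q * \<tau> g * P)"
    "g \<in> carrier G \<Longrightarrow> P * (Q * \<tau> g * P) = \<tau> g * P"
proof -
  note as = assoc_mult_mat[of _ n n _ n _ n] and mc = mult_carrier_mat[of _ n n _ n]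
  have P: "P * (Q * X) = X" if "X \<in> carrier_mat n n" for X
    using as[OF PQ(1,2) that] PQ(3) that by simp
  have 1: "P * (Q * \<tau> g * P) = \<tau> g * P" if g: "g \<in> carrier G" for g
    using P[OF mc[OF is_repD(1)[OF \<tau> g] PQ(1)]] as[OF PQ(2) is_repD(1)[OF \<tau> g] PQ(1)] by simp
  show r: "is_rep n (\<lambda>g. Q * \<tau> g * P)"
    unfolding is_rep_def
  proof (intro conjI ballI)
    show "Q * \<tau> \<one> * P = 1\<^sub>m n" using PQ is_repD(2)[OF \<tau>] by simp
    fix g assume g: "g \<in> carrier G"
    note c = is_repD(1)[OF \<tau> g]
    show "Q * \<tau> g * P \<in> carrier_mat n n" by (intro mc PQ c)
    fix h assume h: "h \<in> carrier G"
    note d = is_repD(1)[OF \<tau> h]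
    have "Q * \<tau> g * P * (Q * \<tau> h * P) = Q * \<tau> g * (P * (Q * \<tau> h * P))"
      by (rule as[OF mc[OF PQ(2) c] PQ(1) mc[OF mc[OF PQ(2) d] PQ(1)]])
    also have "P * (Q * \<tau> h * P) = \<tau> h * P" by (rule 1[OF h])
    also have "Q * \<tau> g * (\<tau> h * P) = Q * \<tau> g * \<tau> h * P"
      by (rule as[OF mc[OF PQ(2) c] d PQ(1), symmetric])
    also have "Q * \<tau> g * \<tau> h = Q * \<tau> (g \<otimes> h)"
      unfolding is_repD(3)[OF \<tau> g h] by (rule as[OF PQ(2) c d])
    finally show "Q * \<tau> (g \<otimes> h) * P = Q * \<tau> g * P * (Q * \<tau> h * P)" ..
  qed
  show "g \<in> carrier G \<Longrightarrow> P * (Q * \<tau> g * P) = \<tau> g * P" by (rule 1)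
  have "\<forall>g \<in> carrier G. P * (Q * \<tau> g * P) = \<tau> g * P" using 1 by blast
  then have "rep_iso G (\<lambda>g. Q * \<tau> g * P) \<tau>"
    unfolding rep_iso_iff[OF r \<tau>] using PQ by blast
  then show "rep_iso G \<tau> (\<lambda>g. Q * \<tau> g * P)" by (rule rep_iso_sym[OF r \<tau>])
qed

text \<open>
  Maschke: the off-diagonal block \<open>\<beta>\<close> satisfies \<open>\<beta> (g h) = \<alpha> g \<beta> h + \<beta> g \<delta> h\<close>, so averaging
  \<open>\<beta> h \<delta> (inv h)\<close> over the group gives \<open>Y\<close> with \<open>\<alpha> g Y + \<beta> g = Y \<delta> g\<close>, and conjugation by
  the unitriangular matrix with entry \<open>-Y\<close> removes \<open>\<beta>\<close>.
\<close>

lemma block_triangular_rep_splits: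
  assumes M: "is_rep (m + n) M"
    and blk: "\<And>g. g \<in> carrier G \<Longrightarrow> M g = four_block_mat (\<alpha> g) (\<beta> g) (0\<^sub>m n m) (\<delta> g)"
    and c: "\<And>g. g \<in> carrier G \<Longrightarrow> \<alpha> g \<in> carrier_mat m m"
      "\<And>g. g \<in> carrier G \<Longrightarrow> \<beta> g \<in> carrier_mat m n"
      "\<And>g. g \<in> carrier G \<Longrightarrow> \<delta> g \<in> carrier_mat n n"
  shows "is_rep m \<alpha>" "is_rep n \<delta>" "rep_iso G M (dsum2 \<alpha> \<delta>)"
proof -
  note z = zero_carrier_mat and o = one_carrier_mat
  have mult: "\<alpha> (g \<otimes> h) = \<alpha> g * \<alpha> h" "\<beta> (g \<otimes> h) = \<alpha> g * \<beta> h + \<beta> g * \<delta> h"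
    "\<delta> (g \<otimes> h) = \<delta> g * \<delta> h" if g: "g \<in> carrier G" and h: "h \<in> carrier G" for g h
  proof -
    note gh = m_closed[OF g h]
    have c': "\<alpha> g * \<alpha> h \<in> carrier_mat m m" "\<alpha> g * \<beta> h \<in> carrier_mat m n"
      "\<beta> g * \<delta> h \<in> carrier_mat m n" "\<delta> g * \<delta> h \<in> carrier_mat n n"
      by (auto intro!: mult_carrier_mat c g h)
    have "M (g \<otimes> h) = four_block_mat (\<alpha> g * \<alpha> h) (\<alpha> g * \<beta> h + \<beta> g * \<delta> h) (0\<^sub>m n m) (\<delta> g * \<delta> h)"
      unfolding is_repD(3)[OF M g h] blk[OF g] blk[OF h]
        mult_four_block_mat[OF c(1)[OF g] c(2)[OF g] z c(3)[OF g] c(1)[OF h] c(2)[OF h] z c(3)[OF h]]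
      using c[OF g] c[OF h] c' by simp
    then have "four_block_mat (\<alpha> (g \<otimes> h)) (\<beta> (g \<otimes> h)) (0\<^sub>m n m) (\<delta> (g \<otimes> h)) =
      four_block_mat (\<alpha> g * \<alpha> h) (\<alpha> g * \<beta> h + \<beta> g * \<delta> h) (0\<^sub>m n m) (\<delta> g * \<delta> h)"
      using blk[OF gh] by simp
    from four_block_mat_inj[OF this c(1)[OF gh] c(2)[OF gh] z c(3)[OF gh] c'(1) _ z c'(4)] c'
    show "\<alpha> (g \<otimes> h) = \<alpha> g * \<alpha> h" "\<beta> (g \<otimes> h) = \<alpha> g * \<beta> h + \<beta> g * \<delta> h" "\<delta> (g \<otimes> h) = \<delta> g * \<delta> h"
      by simp_all
  qed
  have "four_block_mat (\<alpha> \<one>) (\<beta> \<one>) (0\<^sub>m n m) (\<delta> \<one>) =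
      four_block_mat (1\<^sub>m m) (0\<^sub>m m n) (0\<^sub>m n m) (1\<^sub>m n)"
    using blk[OF one_closed] is_repD(2)[OF M] by simp
  from four_block_mat_inj[OF this c(1)[OF one_closed] c(2)[OF one_closed] z c(3)[OF one_closed] o z z o]
  have one: "\<alpha> \<one> = 1\<^sub>m m" "\<delta> \<one> = 1\<^sub>m n" by simp_all
  show \<alpha>: "is_rep m \<alpha>" and \<delta>: "is_rep n \<delta>"
    using one mult c by (auto simp: is_rep_def)
  define S where "S = msum m n (\<lambda>h. \<beta> h * \<delta> (inv h)) (carrier G)"
  have S: "S \<in> carrier_mat m n" by (simp add: S_def)
  \<comment> \<open>\<open>S\<close> is the sum before division by the group order; dividing gives
    the identity for \<open>Y\<close> with coefficient 1 at \<open>\<beta> g\<close>.\<close>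
  have key: "S * \<delta> g = \<alpha> g * S + of_nat (card (carrier G)) \<cdot>\<^sub>m \<beta> g" if g: "g \<in> carrier G" for g
  proof -
    have "S * \<delta> g = msum m n (\<lambda>h. \<beta> h * \<delta> (inv h) * \<delta> g) (carrier G)"
      unfolding S_def by (rule msum_mult) (auto intro!: mult_carrier_mat c g)
    also have "\<dots> = msum m n (\<lambda>h. \<beta> (g \<otimes> h) * \<delta> (inv (g \<otimes> h)) * \<delta> g) (carrier G)"
    proof (rule msum_reindex[symmetric])
      show "bij_betw (\<lambda>h. g \<otimes> h) (carrier G) (carrier G)"
        using g by (intro bij_betw_byWitness[where f' = "\<lambda>h. inv g \<otimes> h"])
          (auto simp: m_assoc[symmetric])
    qed
    also have "\<dots> = msum m n (\<lambda>h. \<alpha> g * (\<beta> h * \<delta> (inv h)) + \<beta> g) (carrier G)"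
    proof (rule msum_cong)
      fix h assume h: "h \<in> carrier G"
      note hi = inv_closed[OF h] and gh = m_closed[OF g h]
      have "\<beta> (g \<otimes> h) * \<delta> (inv (g \<otimes> h)) * \<delta> g = \<beta> (g \<otimes> h) * (\<delta> (inv (g \<otimes> h)) * \<delta> g)"
        by (rule assoc_mult_mat[of _ m n _ n _ n]) (auto intro!: c g h)
      also have "\<delta> (inv (g \<otimes> h)) * \<delta> g = \<delta> (inv h)"
        using g h by (simp add: mult(3)[symmetric] inv_mult_group m_assoc)
      also have "\<beta> (g \<otimes> h) * \<delta> (inv h) = \<alpha> g * \<beta> h * \<delta> (inv h) + \<beta> g * \<delta> h * \<delta> (inv h)"
        unfolding mult(2)[OF g h]
        by (rule add_mult_distrib_mat[of _ m n _ _ n]) (auto intro!: mult_carrier_mat c g h)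
      also have "\<alpha> g * \<beta> h * \<delta> (inv h) = \<alpha> g * (\<beta> h * \<delta> (inv h))"
        by (rule assoc_mult_mat[of _ m m _ n _ n]) (auto intro!: c g h)
      also have "\<beta> g * \<delta> h * \<delta> (inv h) = \<beta> g * (\<delta> h * \<delta> (inv h))"
        by (rule assoc_mult_mat[of _ m n _ n _ n]) (auto intro!: c g h)
      also have "\<beta> g * (\<delta> h * \<delta> (inv h)) = \<beta> g"
        using is_rep_inv(1)[OF \<delta> h] c(2)[OF g] by simp
      finally show "\<beta> (g \<otimes> h) * \<delta> (inv (g \<otimes> h)) * \<delta> g = \<alpha> g * (\<beta> h * \<delta> (inv h)) + \<beta> g" .
    qed
    also have "\<dots> = msum m n (\<lambda>h. \<alpha> g * (\<beta> h * \<delta> (inv h))) (carrier G) + of_nat (card (carrier G)) \<cdot>\<^sub>m \<beta> g"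
      using c(2)[OF g] by (intro eq_matI) (auto simp: sum.distrib)
    also have "msum m n (\<lambda>h. \<alpha> g * (\<beta> h * \<delta> (inv h))) (carrier G) = \<alpha> g * S"
      unfolding S_def by (rule mult_msum[symmetric]) (auto intro!: mult_carrier_mat c g)
    finally show ?thesis .
  qed
  have o0: "of_nat (card (carrier G)) \<noteq> (0 :: complex)"
    using one_closed by (auto simp: card_eq_0_iff)
  define Y where "Y = (1 / of_nat (card (carrier G))) \<cdot>\<^sub>m S"
  have Y: "Y \<in> carrier_mat m n" by (simp add: Y_def S)
  have key': "Y * \<delta> g = \<alpha> g * Y + \<beta> g" if g: "g \<in> carrier G" for g
  proof -
    have "Y * \<delta> g = (1 / of_nat (card (carrier G))) \<cdot>\<^sub>m (S * \<delta> g)"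
      unfolding Y_def by (rule mult_smult_assoc_mat[OF S c(3)[OF g]])
    also have "\<dots> = (1 / of_nat (card (carrier G))) \<cdot>\<^sub>m (\<alpha> g * S) + \<beta> g"
      unfolding key[OF g] using o0 c[OF g] S by (intro eq_matI) (auto simp: distrib_left)
    also have "(1 / of_nat (card (carrier G))) \<cdot>\<^sub>m (\<alpha> g * S) = \<alpha> g * Y"
      unfolding Y_def by (rule mult_smult_distrib[OF c(1)[OF g] S, symmetric])
    finally show ?thesis .
  qed
  let ?P = "four_block_mat (1\<^sub>m m) (- Y) (0\<^sub>m n m) (1\<^sub>m n)"
  let ?Q = "four_block_mat (1\<^sub>m m) Y (0\<^sub>m n m) (1\<^sub>m n)"
  have Y': "- Y \<in> carrier_mat m n" using Y by simp
  have YY: "Y + - Y = 0\<^sub>m m n" "- Y + Y = 0\<^sub>m m n" using Y by (auto intro!: eq_matI)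
  have 1: "?P * ?Q = 1\<^sub>m (m + n)" "?Q * ?P = 1\<^sub>m (m + n)"
    unfolding mult_four_block_mat[OF o Y' z o o Y z o] mult_four_block_mat[OF o Y z o o Y' z o]
    using Y Y' YY by (auto intro!: eq_matI)
  have 2: "?P * M g = dsum2 \<alpha> \<delta> g * ?P" if g: "g \<in> carrier G" for g
  proof -
    have e: "\<beta> g + - Y * \<delta> g = \<alpha> g * - Y"
    proof (rule eq_matI)
      fix i j assume "i < dim_row (\<alpha> g * - Y)" "j < dim_col (\<alpha> g * - Y)"
      then have ij: "i < m" "j < n" using c[OF g] Y by auto
      have "- Y * \<delta> g = - (Y * \<delta> g)" "\<alpha> g * - Y = - (\<alpha> g * Y)"
        using c[OF g] Y by (simp_all add: uminus_mult_left_mat uminus_mult_right_mat)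
      then show "(\<beta> g + - Y * \<delta> g) $$ (i, j) = (\<alpha> g * - Y) $$ (i, j)"
        unfolding key'[OF g] using ij c[OF g] Y by (simp add: key'[OF g])
    qed (use c[OF g] Y in auto)
    \<comment> \<open>The lower right block of \<open>dsum2 \<alpha> \<delta> g * ?P\<close>
      contains the product of a zero block with \<open>- Y\<close>, which simplifies to a negated
      zero matrix.\<close>
    have "- 0\<^sub>m n n + \<delta> g = \<delta> g" using c(3)[OF g] by (intro eq_matI) auto
    then show ?thesis
      unfolding blk[OF g] dsum2_eq[OF \<alpha> \<delta> g]
        mult_four_block_mat[OF o Y' z o c(1)[OF g] c(2)[OF g] z c(3)[OF g]]
        mult_four_block_mat[OF c(1)[OF g] z z c(3)[OF g] o Y' z o]
      using c[OF g] Y Y' e mult_carrier_mat[OF c(1)[OF g] Y'] by simp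
  qed
  show "rep_iso G M (dsum2 \<alpha> \<delta>)"
    unfolding rep_iso_iff[OF M is_rep_dsum2[OF \<alpha> \<delta>]]
    by (rule exI[of _ ?P], rule exI[of _ ?Q]) (use 1 2 in auto)
qed

text \<open>In a basis adapted to a proper nonzero invariant subspace the representation is block
  upper triangular, and \<open>block_triangular_rep_splits\<close> removes the off-diagonal
  block.\<close>

lemma reducible_rep_splits:
  assumes \<tau>: "is_rep n \<tau>" and n: "n \<noteq> 0" and red: "\<not> irreducible_rep G \<tau>"
  obtains a b \<alpha> \<beta> where "a < n" "b < n" "is_rep a \<alpha>" "is_rep b \<beta>" "rep_iso G \<tau> (dsum2 \<alpha> \<beta>)"
proof -
  have "representation G \<tau>" using \<tau> representation_iff_is_rep is_rep_degree by metis
  then obtain W where W: "VectorSpace.subspace class_ring W (module_vec TYPE(complex) n)"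
      and inv: "\<And>g w. g \<in> carrier G \<Longrightarrow> w \<in> W \<Longrightarrow> \<tau> g *\<^sub>v w \<in> W"
      and nt: "W \<noteq> {0\<^sub>v n}" "W \<noteq> carrier_vec n"
    using red n unfolding irreducible_rep_def is_rep_degree[OF \<tau>] by blast
  note Wc = subspace_closed[OF W]
  obtain P k where P: "P \<in> carrier_mat n n" "det P \<noteq> 0" "k \<le> n" "\<And>j. j < k \<Longrightarrow> col P j \<in> W"
    and ad: "\<And>x l. x \<in> carrier_vec n \<Longrightarrow> P *\<^sub>v x \<in> W \<Longrightarrow> k \<le> l \<Longrightarrow> l < n \<Longrightarrow> x $ l = 0"
    using adapted_basis[OF Wc(1)] by metis
  obtain Q where Q: "Q \<in> carrier_mat n n" "P * Q = 1\<^sub>m n" "Q * P = 1\<^sub>m n"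
    using det_nonzero_obtain_inverse[OF P(1,2)] by blast
  have PQv: "P *\<^sub>v (Q *\<^sub>v v) = v" if "v \<in> carrier_vec n" for v
    using assoc_mult_mat_vec[OF P(1) Q(1) that] Q(2) that by simp
  \<comment> \<open>For \<open>k = 0\<close> the subspace would be zero, for \<open>k = n\<close>
    the whole space. Excluding both makes the two diagonal blocks strictly smaller than
    \<open>n\<close>, as the induction on the degree requires.\<close>
  have k0: "k \<noteq> 0"
  proof
    assume k: "k = 0"
    have "w = 0\<^sub>v n" if "w \<in> W" for w
    proof -
      have w: "w \<in> carrier_vec n" using that Wc by auto
      have "Q *\<^sub>v w = 0\<^sub>v n"
        using ad[of "Q *\<^sub>v w"] that PQv[OF w] w Q k by (intro eq_vecI) auto
      then have "w = P *\<^sub>v 0\<^sub>v n" using PQv[OF w] by simp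
      also have "\<dots> = 0\<^sub>v n" using P by (intro eq_vecI) auto
      finally show ?thesis .
    qed
    then have "W = {0\<^sub>v n}" using Wc(2) by blast
    with nt show False by simp
  qed
  have kn: "k \<noteq> n"
  proof
    assume k: "k = n"
    have "v \<in> W" if v: "v \<in> carrier_vec n" for v
      using mult_vec_in_subspace[OF W P(1,4,3), of "Q *\<^sub>v v"] PQv[OF v] v Q k by auto
    with Wc(1) nt show False by auto
  qed
  define M where "M g = Q * \<tau> g * P" for g
  note MM = is_rep_conjugate[OF \<tau> P(1) Q, folded M_def]
  \<comment> \<open>Column \<open>j\<close> of \<open>M g\<close> holds the coordinates of
    \<open>\<tau> g *\<^sub>v col P j\<close> in the basis \<open>P\<close>. This vector stays in
    \<open>W\<close>, and vectors of \<open>W\<close> have no coordinates from \<open>k\<close>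
    on.\<close>
  have Mz: "M g $$ (l, j) = 0" if g: "g \<in> carrier G" and l: "k \<le> l" "l < n" and j: "j < k" for g l j
  proof -
    note Mc = is_repD(1)[OF MM(1) g]
    have jn: "j < n" using j P(3) by simp
    have "P *\<^sub>v col (M g) j = col (P * M g) j" using col_mult2[OF P(1) Mc jn] by simp
    also have "\<dots> = \<tau> g *\<^sub>v col P j"
      unfolding MM(3)[OF g] by (rule col_mult2[OF is_repD(1)[OF \<tau> g] P(1) jn])
    also have "\<dots> \<in> W" by (rule inv[OF g P(4)[OF j]])
    finally have "col (M g) j $ l = 0" using Mc l by (intro ad) auto
    then show ?thesis using Mc l jn by simp
  qed
  define \<alpha> where "\<alpha> g = mat k k (\<lambda>ij. M g $$ ij)" for g
  define \<beta> where "\<beta> g = mat k (n - k) (\<lambda>(i, j). M g $$ (i, j + k))" for g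
  define \<delta> where "\<delta> g = mat (n - k) (n - k) (\<lambda>(i, j). M g $$ (i + k, j + k))" for g
  have knn: "k + (n - k) = n" using P(3) by simp
  have "M g = four_block_mat (\<alpha> g) (\<beta> g) (0\<^sub>m (n - k) k) (\<delta> g)" if g: "g \<in> carrier G" for g
    using is_repD(1)[OF MM(1) g] knn Mz[OF g] by (intro eq_matI) (auto simp: \<alpha>_def \<beta>_def \<delta>_def)
  note split = block_triangular_rep_splits[OF _ this, unfolded knn, OF MM(1)]
  have sp: "is_rep k \<alpha>" "is_rep (n - k) \<delta>" "rep_iso G M (dsum2 \<alpha> \<delta>)"
    by (rule split; simp add: \<alpha>_def \<beta>_def \<delta>_def)+
  have "rep_iso G \<tau> (dsum2 \<alpha> \<delta>)"
    using rep_iso_trans[OF \<tau> MM(1) is_rep_dsum2[OF sp(1,2)] MM(2) sp(3)] .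
  then show thesis using that[OF _ _ sp(1,2)] k0 kn P(3) by simp
qed

lemma irreducible_repD:
  "irreducible_rep G \<rho> \<Longrightarrow> representation G \<rho>" "irreducible_rep G \<rho> \<Longrightarrow> rep_degree G \<rho> \<noteq> 0"
  by (auto simp: irreducible_rep_def)

lemma completely_reducible:
  assumes "representation G \<tau>"
  shows "\<exists>\<sigma>s. (\<forall>\<sigma> \<in> set \<sigma>s. irreducible_rep G \<sigma>) \<and> rep_iso G \<tau> (direct_sum_rep \<sigma>s)"
  using assms
proof (induction "rep_degree G \<tau>" arbitrary: \<tau> rule: less_induct)
  case less
  let ?n = "rep_degree G \<tau>"
  have \<tau>: "is_rep ?n \<tau>" using less.prems representation_iff_is_rep by simp
  show ?case
  proof (cases "?n = 0 \<or> irreducible_rep G \<tau>")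
    case True
    then show ?thesis
    proof
      \<comment> \<open>A representation of degree 0 is not irreducible; it is the direct sum of the
        empty list.\<close>
      assume 0: "?n = 0"
      have "rep_iso G \<tau> (direct_sum_rep [])"
        unfolding direct_sum_rep_Nil rep_iso_iff[OF \<tau>[unfolded 0] is_rep_zero]
        by (rule exI[of _ "0\<^sub>m 0 0"], rule exI[of _ "0\<^sub>m 0 0"])
          (use is_repD(1)[OF \<tau>[unfolded 0]] in \<open>fastforce intro!: eq_matI\<close>)
      then show ?thesis by (intro exI[of _ "[]"]) simp
    next
      assume "irreducible_rep G \<tau>"
      then show ?thesis
        using less.prems by (intro exI[of _ "[\<tau>]"]) (simp add: direct_sum_rep_singleton)
    qed
  next
    case False
    then obtain a b \<alpha> \<beta> where ab: "a < ?n" "b < ?n" "is_rep a \<alpha>" "is_rep b \<beta>"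
      "rep_iso G \<tau> (dsum2 \<alpha> \<beta>)"
      using reducible_rep_splits[OF \<tau>] by metis
    have r: "representation G \<alpha>" "representation G \<beta>"
      using is_rep_imp_representation ab(3,4) by blast+
    obtain xs ys where xs: "\<forall>\<sigma> \<in> set xs. irreducible_rep G \<sigma>" "rep_iso G \<alpha> (direct_sum_rep xs)"
        and ys: "\<forall>\<sigma> \<in> set ys. irreducible_rep G \<sigma>" "rep_iso G \<beta> (direct_sum_rep ys)"
      using less.hyps[of \<alpha>] less.hyps[of \<beta>] ab r by (auto simp: is_rep_degree)
    have r': "representation G (direct_sum_rep xs)" "representation G (direct_sum_rep ys)"
      using xs ys irreducible_repD(1) by (auto intro!: representation_direct_sum)
    have "rep_iso G \<tau> (direct_sum_rep (xs @ ys))"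
      unfolding direct_sum_rep_append
      by (rule rep_iso_trans'[OF less.prems _ _ ab(5)])
        (use r r' xs ys in \<open>auto intro!: representation_dsum2 rep_iso_dsum2_cong'\<close>)
    then show ?thesis using xs ys by (intro exI[of _ "xs @ ys"]) auto
  qed
qed

lemma mset_concat_replicate_count:
  assumes "set js \<subseteq> {..<r}"
  shows "mset (concat (map (\<lambda>j. replicate (count (mset js) j) j) [0..<r])) = mset js"
proof (rule multiset_eqI)
  fix x
  have "count (mset (concat (map (\<lambda>j. replicate (f j) j) [0..<r]))) x = (if x < r then f x else 0)"
    for f :: "nat \<Rightarrow> nat"
    by (induction r) (auto simp: less_Suc_eq)
  then show "count (mset (concat (map (\<lambda>j. replicate (count (mset js) j) j) [0..<r]))) x = count (mset js) x"
    using assms by (auto simp: count_eq_zero_iff)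
qed

text \<open>Each irreducible summand is exchanged for the listed representative isomorphic to it,
  and the summands are then sorted by index. \<open>m j\<close> counts how often the index
  \<open>j\<close> was chosen.\<close>

lemma isotypic_decomposition:
  assumes \<sigma>s: "complete_irreps G \<sigma>s" and \<tau>: "representation G \<tau>"
  shows "\<exists>m. rep_iso G \<tau> (direct_sum_rep
    (concat (map (\<lambda>j. replicate (m j) (\<sigma>s ! j)) [0..<length \<sigma>s])))"
proof -
  let ?r = "length \<sigma>s"
  obtain xs where xs: "\<forall>\<sigma> \<in> set xs. irreducible_rep G \<sigma>" "rep_iso G \<tau> (direct_sum_rep xs)"
    using completely_reducible[OF \<tau>] by blast
  have "\<forall>\<sigma> \<in> set xs. \<exists>j<?r. rep_iso G \<sigma> (\<sigma>s ! j)"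
    using \<sigma>s xs by (auto simp: complete_irreps_def)
  then obtain f where f: "\<And>\<sigma>. \<sigma> \<in> set xs \<Longrightarrow> f \<sigma> < ?r \<and> rep_iso G \<sigma> (\<sigma>s ! f \<sigma>)" by metis
  define js where "js = map f xs"
  have js: "set js \<subseteq> {..<?r}" using f by (auto simp: js_def)
  have irr: "representation G (\<sigma>s ! j)" if "j < ?r" for j
    using \<sigma>s that by (auto simp: complete_irreps_def intro: irreducible_repD)
  define ys where "ys = map (\<lambda>j. \<sigma>s ! j) js"
  define zs where "zs = concat (map (\<lambda>j. replicate (count (mset js) j) (\<sigma>s ! j)) [0..<?r])"
  have zs: "zs = map (\<lambda>j. \<sigma>s ! j) (concat (map (\<lambda>j. replicate (count (mset js) j) j) [0..<?r]))"
    by (simp add: zs_def map_concat comp_def map_replicate)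
  have ms: "mset ys = mset zs"
    unfolding zs ys_def mset_map mset_concat_replicate_count[OF js] ..
  have repys: "\<forall>\<sigma> \<in> set ys. representation G \<sigma>" using js irr by (auto simp: ys_def)
  have repzs: "\<forall>\<sigma> \<in> set zs. representation G \<sigma>" using repys mset_eq_setD[OF ms] by simp
  have 1: "rep_iso G (direct_sum_rep xs) (direct_sum_rep ys)"
    by (rule rep_iso_direct_sum_cong)
      (use f irr xs irreducible_repD in \<open>auto simp: ys_def js_def list_all2_conv_all_nth\<close>)
  have 2: "rep_iso G (direct_sum_rep ys) (direct_sum_rep zs)"
    by (rule rep_iso_direct_sum_mset[OF ms repys])
  have r: "representation G (direct_sum_rep xs)" "representation G (direct_sum_rep ys)"
    "representation G (direct_sum_rep zs)"
    using xs repys repzs irreducible_repD(1) by (auto intro!: representation_direct_sum)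
  have "rep_iso G \<tau> (direct_sum_rep zs)"
    using rep_iso_trans'[OF \<tau> r(1,2) xs(2) 1] rep_iso_trans'[OF \<tau> r(2,3) _ 2] by blast
  then show ?thesis unfolding zs_def by blast
qed

end

section \<open>Schur's lemma and the orthogonality relations\<close>

lemma subspaceI:
  assumes "W \<subseteq> carrier_vec n" "0\<^sub>v n \<in> W"
    "\<And>v w. v \<in> W \<Longrightarrow> w \<in> W \<Longrightarrow> v + w \<in> W" "\<And>c v. v \<in> W \<Longrightarrow> c \<cdot>\<^sub>v v \<in> W"
  shows "VectorSpace.subspace class_ring W (module_vec TYPE(complex) n)"
proof -
  have "vectorspace class_ring (module_vec TYPE(complex) n)" by (rule vec_vs)
  moreover from this have "Module.module class_ring (module_vec TYPE(complex) n)"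
    by (simp add: vectorspace_def)
  ultimately show ?thesis
    using assms unfolding VectorSpace.subspace_def LinearCombinations.submodule_def
    by (auto simp: module_vec_simps)
qed

lemma mat_eq_zeroI:
  assumes M: "M \<in> carrier_mat n m" and z: "\<And>v. v \<in> carrier_vec m \<Longrightarrow> M *\<^sub>v v = 0\<^sub>v n"
  shows "M = (0\<^sub>m n m :: complex mat)"
proof (rule eq_matI)
  fix i j assume "i < dim_row (0\<^sub>m n m :: complex mat)" "j < dim_col (0\<^sub>m n m :: complex mat)"
  then have ij: "i < n" "j < m" by auto
  have "M $$ (i, j) = (M *\<^sub>v unit_vec m j) $ i" using M ij by simp
  also have "\<dots> = 0" using z[of "unit_vec m j"] ij by simp
  finally show "M $$ (i, j) = 0\<^sub>m n m $$ (i, j)" using ij by simp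
qed (use M in auto)

definition chi :: "('g \<Rightarrow> complex mat) \<Rightarrow> 'g \<Rightarrow> complex" where
  "chi \<rho> g = mtrace (\<rho> g)"

context finite_group
begin

lemma irreducible_repE:
  assumes "irreducible_rep G \<sigma>"
  obtains n where "is_rep n \<sigma>" "n \<noteq> 0"
    "\<And>W. VectorSpace.subspace class_ring W (module_vec TYPE(complex) n) \<Longrightarrow>
      (\<And>g w. g \<in> carrier G \<Longrightarrow> w \<in> W \<Longrightarrow> \<sigma> g *\<^sub>v w \<in> W) \<Longrightarrow> W = {0\<^sub>v n} \<or> W = carrier_vec n"
proof
  show "is_rep (rep_degree G \<sigma>) \<sigma>"
    using assms representation_iff_is_rep by (simp add: irreducible_rep_def)
qed (use assms in \<open>auto simp: irreducible_rep_def\<close>)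

text \<open>The null space of an intertwiner is invariant under \<open>\<sigma>\<close>, so
  irreducibility leaves only the two extreme cases.\<close>

lemma intertwiner_zero_or_injective:
  assumes irr: "irreducible_rep G \<sigma>" and \<sigma>: "is_rep m \<sigma>" and \<tau>: "is_rep n \<tau>"
    and M: "M \<in> carrier_mat n m" "\<And>g. g \<in> carrier G \<Longrightarrow> M * \<sigma> g = \<tau> g * M"
  shows "M = 0\<^sub>m n m \<or> (\<forall>v \<in> carrier_vec m. M *\<^sub>v v = 0\<^sub>v n \<longrightarrow> v = 0\<^sub>v m)"
proof -
  define W where "W = {v \<in> carrier_vec m. M *\<^sub>v v = 0\<^sub>v n}"
  have "VectorSpace.subspace class_ring W (module_vec TYPE(complex) m)"
  proof (rule subspaceI)
    show "0\<^sub>v m \<in> W" using M by (auto simp: W_def intro!: eq_vecI)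
  qed (use M in \<open>auto simp: W_def mult_add_distrib_mat_vec[of _ n m] mult_mat_vec[of _ n m]\<close>)
  moreover have "\<sigma> g *\<^sub>v w \<in> W" if g: "g \<in> carrier G" and w: "w \<in> W" for g w
  proof -
    note c = is_repD(1)[OF \<sigma> g] is_repD(1)[OF \<tau> g]
    have wc: "w \<in> carrier_vec m" using w by (simp add: W_def)
    have "M *\<^sub>v (\<sigma> g *\<^sub>v w) = \<tau> g *\<^sub>v (M *\<^sub>v w)"
      using assoc_mult_mat_vec[OF M(1) c(1) wc] assoc_mult_mat_vec[OF c(2) M(1) wc] M(2)[OF g] by simp
    also have "\<dots> = 0\<^sub>v n" using w c by (auto simp: W_def intro!: eq_vecI)
    finally show ?thesis using c wc by (simp add: W_def mult_mat_vec_carrier[of _ m m])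
  qed
  moreover have "is_rep n \<sigma> \<Longrightarrow> n = m" for n using \<sigma> is_rep_degree by metis
  ultimately have "W = {0\<^sub>v m} \<or> W = carrier_vec m"
    using irreducible_repE[OF irr] by metis
  then show ?thesis
  proof
    assume "W = carrier_vec m"
    then have "M = 0\<^sub>m n m" by (intro mat_eq_zeroI[OF M(1)]) (auto simp: W_def)
    then show ?thesis ..
  qed (auto simp: W_def)
qed

text \<open>A nonzero intertwiner is injective. Its image is a nonzero invariant subspace, hence
  everything; preimages of the unit vectors form a right inverse \<open>X\<close>. From
  \<open>M * (X * M - 1) = 0\<close> and injectivity, \<open>X\<close> is a left inverse
  too.\<close>

lemma schur_zero_or_iso:
  assumes irr: "irreducible_rep G \<sigma>" "irreducible_rep G \<tau>" and \<sigma>: "is_rep m \<sigma>" and \<tau>: "is_rep n \<tau>"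
    and M: "M \<in> carrier_mat n m" "\<And>g. g \<in> carrier G \<Longrightarrow> M * \<sigma> g = \<tau> g * M"
  shows "M = 0\<^sub>m n m \<or> rep_iso G \<sigma> \<tau>"
proof (rule disjCI)
  assume nz: "\<not> rep_iso G \<sigma> \<tau>"
  show "M = 0\<^sub>m n m"
  proof (rule ccontr)
    assume M0: "M \<noteq> 0\<^sub>m n m"
    then have inj: "\<And>v. v \<in> carrier_vec m \<Longrightarrow> M *\<^sub>v v = 0\<^sub>v n \<Longrightarrow> v = 0\<^sub>v m"
      using intertwiner_zero_or_injective[OF irr(1) \<sigma> \<tau> M] by blast
    define W where "W = (\<lambda>v. M *\<^sub>v v) ` carrier_vec m"
    have "VectorSpace.subspace class_ring W (module_vec TYPE(complex) n)"
    proof (rule subspaceI)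
      show "W \<subseteq> carrier_vec n" using M(1) by (auto simp: W_def)
      have "M *\<^sub>v 0\<^sub>v m = 0\<^sub>v n" using M(1) by (auto intro!: eq_vecI)
      then show "0\<^sub>v n \<in> W" unfolding W_def by (metis imageI zero_carrier_vec)
      show "v + w \<in> W" if "v \<in> W" "w \<in> W" for v w
        using that mult_add_distrib_mat_vec[OF M(1), symmetric] unfolding W_def
        by (auto intro!: imageI)
      show "c \<cdot>\<^sub>v v \<in> W" if "v \<in> W" for c v
        using that mult_mat_vec[OF M(1), symmetric] unfolding W_def by (auto intro!: imageI)
    qed
    moreover have "\<tau> g *\<^sub>v w \<in> W" if g: "g \<in> carrier G" and w: "w \<in> W" for g w
    proof -
      note c = is_repD(1)[OF \<sigma> g] is_repD(1)[OF \<tau> g]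
      obtain v where v: "v \<in> carrier_vec m" "w = M *\<^sub>v v" using w by (auto simp: W_def)
      have "\<tau> g *\<^sub>v w = M *\<^sub>v (\<sigma> g *\<^sub>v v)"
        using assoc_mult_mat_vec[OF M(1) c(1) v(1)] assoc_mult_mat_vec[OF c(2) M(1) v(1)]
          M(2)[OF g] v by simp
      then show ?thesis using mult_mat_vec_carrier[OF c(1) v(1)] by (auto simp: W_def)
    qed
    moreover have "is_rep k \<tau> \<Longrightarrow> k = n" for k using \<tau> is_rep_degree by metis
    ultimately have "W = {0\<^sub>v n} \<or> W = carrier_vec n"
      using irreducible_repE[OF irr(2)] by metis
    moreover have "W \<noteq> {0\<^sub>v n}"
      using M0 mat_eq_zeroI[OF M(1)] unfolding W_def by blast
    ultimately have surj: "W = carrier_vec n" by blast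
    have "\<forall>i. \<exists>x. x \<in> carrier_vec m \<and> M *\<^sub>v x = unit_vec n i"
      using surj unit_vec_carrier[of n] unfolding W_def by (metis imageE)
    then obtain x where x: "\<And>i. x i \<in> carrier_vec m" "\<And>i. M *\<^sub>v x i = unit_vec n i" by metis
    define X where "X = mat m n (\<lambda>(l, i). x i $ l)"
    have X: "X \<in> carrier_mat m n" by (simp add: X_def)
    have colX: "col X i = x i" if "i < n" for i
      using that x(1)[of i] by (auto simp: X_def intro!: eq_vecI)
    have MX: "M * X = 1\<^sub>m n"
    proof (rule mat_col_eqI)
      fix i assume "i < dim_col (1\<^sub>m n :: complex mat)"
      then have i: "i < n" by simp
      have "col (M * X) i = M *\<^sub>v col X i" using col_mult2[OF M(1) X i] .
      then show "col (M * X) i = col (1\<^sub>m n) i" using x colX[OF i] i by simp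
    qed (use M X in auto)
    have XM: "X * M = 1\<^sub>m m"
    proof -
      have XMc: "X * M \<in> carrier_mat m m" using X M(1) by simp
      have D: "X * M - 1\<^sub>m m \<in> carrier_mat m m" by (rule minus_carrier_mat[OF one_carrier_mat])
      have "M * (X * M - 1\<^sub>m m) = M * (X * M) - M * 1\<^sub>m m"
        by (rule mult_minus_distrib_mat[OF M(1) XMc one_carrier_mat])
      also have "M * (X * M) = M" using assoc_mult_mat[OF M(1) X M(1)] MX M(1) by simp
      finally have MD: "M * (X * M - 1\<^sub>m m) = 0\<^sub>m n m"
        using M(1) by (auto intro!: eq_matI)
      have "X * M - 1\<^sub>m m = 0\<^sub>m m m"
      proof (rule mat_eq_zeroI[OF D])
        fix v :: "complex vec" assume v: "v \<in> carrier_vec m"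
        have "M *\<^sub>v ((X * M - 1\<^sub>m m) *\<^sub>v v) = 0\<^sub>m n m *\<^sub>v v"
          using assoc_mult_mat_vec[OF M(1) D v] MD by simp
        also have "\<dots> = 0\<^sub>v n" using v by (auto intro!: eq_vecI)
        finally show "(X * M - 1\<^sub>m m) *\<^sub>v v = 0\<^sub>v m"
          by (rule inj[OF mult_mat_vec_carrier[OF D v]])
      qed
      then have "(X * M - 1\<^sub>m m) $$ (i, j) = 0" if "i < m" "j < m" for i j using that by simp
      then show ?thesis using XMc by (intro eq_matI) auto
    qed
    have "rep_iso G \<sigma> \<tau>" unfolding rep_iso_iff[OF \<sigma> \<tau>]
      using M X MX XM by blast
    with nz show False by simp
  qed
qed

text \<open>Over the complex numbers \<open>M\<close> has an eigenvalue \<open>c\<close>. Then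
  \<open>M - c\<close> is again an intertwiner and kills an eigenvector, so it is not injective and
  must vanish.\<close>

lemma schur_scalar:
  assumes irr: "irreducible_rep G \<sigma>" and \<sigma>: "is_rep n \<sigma>"
    and M: "M \<in> carrier_mat n n" "\<And>g. g \<in> carrier G \<Longrightarrow> M * \<sigma> g = \<sigma> g * M"
  shows "\<exists>c. M = c \<cdot>\<^sub>m 1\<^sub>m n"
proof -
  have n: "n > 0" using irr is_rep_degree[OF \<sigma>] irreducible_repD(2) by auto
  obtain c where "eigenvalue M c" using spectrum_non_empty[OF M(1) n] by (auto simp: spectrum_def)
  then obtain v where v: "v \<in> carrier_vec n" "v \<noteq> 0\<^sub>v n" "M *\<^sub>v v = c \<cdot>\<^sub>v v"
    using M(1) by (auto simp: eigenvalue_def eigenvector_def)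
  define D where "D = M - c \<cdot>\<^sub>m 1\<^sub>m n"
  have c1: "c \<cdot>\<^sub>m 1\<^sub>m n \<in> carrier_mat n n" by simp
  have D: "D \<in> carrier_mat n n" unfolding D_def by (rule minus_carrier_mat[OF c1])
  have "D * \<sigma> g = \<sigma> g * D" if g: "g \<in> carrier G" for g
  proof -
    note s = is_repD(1)[OF \<sigma> g]
    show ?thesis unfolding D_def minus_mult_distrib_mat[OF M(1) c1 s]
        mult_minus_distrib_mat[OF s M(1) c1] M(2)[OF g]
        mult_smult_assoc_mat[OF one_carrier_mat s] mult_smult_distrib[OF s one_carrier_mat]
      using s by simp
  qed
  from intertwiner_zero_or_injective[OF irr \<sigma> \<sigma> D this]
  have alt: "D = 0\<^sub>m n n \<or> (\<forall>v \<in> carrier_vec n. D *\<^sub>v v = 0\<^sub>v n \<longrightarrow> v = 0\<^sub>v n)" by blast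
  have "D *\<^sub>v v = M *\<^sub>v v - (c \<cdot>\<^sub>m 1\<^sub>m n) *\<^sub>v v"
    unfolding D_def by (rule minus_mult_distrib_mat_vec[OF M(1) c1 v(1)])
  also have "(c \<cdot>\<^sub>m 1\<^sub>m n) *\<^sub>v v = c \<cdot>\<^sub>v v"
    using v(1) by (auto intro!: eq_vecI)
  also have "M *\<^sub>v v - c \<cdot>\<^sub>v v = 0\<^sub>v n" using v by (auto intro!: eq_vecI)
  finally have "D = 0\<^sub>m n n" using alt v by blast
  then have "D $$ (i, j) = 0" if "i < n" "j < n" for i j using that by simp
  then have "M = c \<cdot>\<^sub>m 1\<^sub>m n" using M(1) by (intro eq_matI) (auto simp: D_def)
  then show ?thesis ..
qed

text \<open>Left translation by \<open>h\<close> only permutes the summands. Thus an arbitrary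
  matrix \<open>B\<close> yields an intertwiner to which Schur's lemma applies.\<close>

lemma schur_average:
  assumes \<sigma>: "is_rep m \<sigma>" and \<tau>: "is_rep n \<tau>" and B: "B \<in> carrier_mat n m" and h: "h \<in> carrier G"
  defines "S \<equiv> msum n m (\<lambda>g. \<tau> g * B * \<sigma> (inv g)) (carrier G)"
  shows "S * \<sigma> h = \<tau> h * S"
proof -
  note \<sigma>c = is_repD(1)[OF \<sigma>] and \<tau>c = is_repD(1)[OF \<tau>]
  have c: "\<tau> g * B \<in> carrier_mat n m" if "g \<in> carrier G" for g
    by (rule mult_carrier_mat[OF \<tau>c[OF that] B])
  have c': "\<tau> g * B * \<sigma> (inv g) \<in> carrier_mat n m" if "g \<in> carrier G" for g
    by (rule mult_carrier_mat[OF c[OF that] \<sigma>c[OF inv_closed[OF that]]])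
  have "S * \<sigma> h = msum n m (\<lambda>g. \<tau> g * B * \<sigma> (inv g) * \<sigma> h) (carrier G)"
    unfolding S_def by (rule msum_mult[OF \<sigma>c[OF h] c'])
  also have "\<dots> = msum n m (\<lambda>g. \<tau> (h \<otimes> g) * B * \<sigma> (inv (h \<otimes> g)) * \<sigma> h) (carrier G)"
  proof (rule msum_reindex[symmetric])
    show "bij_betw (\<lambda>g. h \<otimes> g) (carrier G) (carrier G)"
      using h by (intro bij_betw_byWitness[where f' = "\<lambda>g. inv h \<otimes> g"])
        (auto simp: m_assoc[symmetric])
  qed
  also have "\<dots> = msum n m (\<lambda>g. \<tau> h * (\<tau> g * B * \<sigma> (inv g))) (carrier G)"
  proof (rule msum_cong)
    fix g assume g: "g \<in> carrier G"
    note hg = m_closed[OF h g]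
    have "\<tau> (h \<otimes> g) * B * \<sigma> (inv (h \<otimes> g)) * \<sigma> h = \<tau> (h \<otimes> g) * B * (\<sigma> (inv (h \<otimes> g)) * \<sigma> h)"
      by (rule assoc_mult_mat[OF c[OF hg] \<sigma>c[OF inv_closed[OF hg]] \<sigma>c[OF h]])
    also have "\<sigma> (inv (h \<otimes> g)) * \<sigma> h = \<sigma> (inv g)"
      using g h by (simp add: is_repD(3)[OF \<sigma>, symmetric] inv_mult_group m_assoc)
    also have "\<tau> (h \<otimes> g) * B * \<sigma> (inv g) = \<tau> h * (\<tau> g * B) * \<sigma> (inv g)"
      unfolding is_repD(3)[OF \<tau> h g] assoc_mult_mat[OF \<tau>c[OF h] \<tau>c[OF g] B] ..
    also have "\<tau> h * (\<tau> g * B) * \<sigma> (inv g) = \<tau> h * (\<tau> g * B * \<sigma> (inv g))"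
      by (rule assoc_mult_mat[OF \<tau>c[OF h] c[OF g] \<sigma>c[OF inv_closed[OF g]]])
    finally show "\<tau> (h \<otimes> g) * B * \<sigma> (inv (h \<otimes> g)) * \<sigma> h = \<tau> h * (\<tau> g * B * \<sigma> (inv g))" .
  qed
  also have "\<dots> = \<tau> h * S"
    unfolding S_def by (rule mult_msum[OF \<tau>c[OF h] c', symmetric])
  finally show ?thesis .
qed

definition mat_unit :: "nat \<Rightarrow> nat \<Rightarrow> nat \<Rightarrow> nat \<Rightarrow> complex mat" where
  "mat_unit m n k l = mat m n (\<lambda>(i, j). if i = k \<and> j = l then 1 else 0)"

text \<open>Taking matrix units for \<open>B\<close> in \<open>schur_average\<close> isolates single
  products of entries, which turns Schur's lemma into entrywise orthogonality.\<close>

lemma mult_mat_unit_mult: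
  assumes A: "A \<in> carrier_mat p m" and C: "C \<in> carrier_mat n q"
    and "k < m" "l < n" "i < p" "j < q"
  shows "(A * mat_unit m n k l * C) $$ (i, j) = A $$ (i, k) * C $$ (l, j)"
proof -
  have U: "mat_unit m n k l \<in> carrier_mat m n" by (simp add: mat_unit_def)
  have 1: "(A * mat_unit m n k l) $$ (i, s) = (if s = l then A $$ (i, k) else 0)" if "s < n" for s
  proof -
    have "(A * mat_unit m n k l) $$ (i, s) = (\<Sum>t<m. A $$ (i, t) * mat_unit m n k l $$ (t, s))"
      by (rule index_mult_mat_sum[OF A U assms(5) that])
    also have "\<dots> = (\<Sum>t<m. if t = k then (if s = l then A $$ (i, k) else 0) else 0)"
      using that by (intro sum.cong) (auto simp: mat_unit_def)
    finally show ?thesis using assms by simp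
  qed
  have "(A * mat_unit m n k l * C) $$ (i, j) = (\<Sum>s<n. (A * mat_unit m n k l) $$ (i, s) * C $$ (s, j))"
    by (rule index_mult_mat_sum[OF mult_carrier_mat[OF A U] C assms(5,6)])
  also have "\<dots> = (\<Sum>s<n. if s = l then A $$ (i, k) * C $$ (l, j) else 0)"
    by (intro sum.cong refl) (simp add: 1 del: index_mult_mat(1))
  finally show ?thesis using assms by simp
qed

lemma schur_orthogonality_noniso:
  assumes irr: "irreducible_rep G \<sigma>" "irreducible_rep G \<tau>" and \<sigma>: "is_rep m \<sigma>" and \<tau>: "is_rep n \<tau>"
    and ni: "\<not> rep_iso G \<sigma> \<tau>" and ij: "i < n" "k < n" "l < m" "j < m"
  shows "(\<Sum>g\<in>carrier G. \<tau> g $$ (i, k) * \<sigma> (inv g) $$ (l, j)) = 0"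
proof -
  let ?B = "mat_unit n m k l"
  define S where "S = msum n m (\<lambda>g. \<tau> g * ?B * \<sigma> (inv g)) (carrier G)"
  have B: "?B \<in> carrier_mat n m" by (simp add: mat_unit_def)
  have "S = 0\<^sub>m n m"
    using schur_zero_or_iso[OF irr \<sigma> \<tau>, of S] schur_average[OF \<sigma> \<tau> B] ni
    by (simp add: S_def)
  then have "S $$ (i, j) = 0" using ij by simp
  then have "(\<Sum>g\<in>carrier G. (\<tau> g * ?B * \<sigma> (inv g)) $$ (i, j)) = 0"
    using ij by (simp add: S_def)
  moreover have "(\<tau> g * ?B * \<sigma> (inv g)) $$ (i, j) = \<tau> g $$ (i, k) * \<sigma> (inv g) $$ (l, j)"
    if g: "g \<in> carrier G" for g
    using ij by (intro mult_mat_unit_mult[OF is_repD(1)[OF \<tau> g] is_repD(1)[OF \<sigma> inv_closed[OF g]]])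
  ultimately show ?thesis by simp
qed

lemma schur_orthogonality_iso:
  assumes irr: "irreducible_rep G \<sigma>" and \<sigma>: "is_rep n \<sigma>"
    and ij: "i < n" "k < n" "l < n" "j < n"
  shows "(\<Sum>g\<in>carrier G. \<sigma> g $$ (i, k) * \<sigma> (inv g) $$ (l, j)) =
    (if i = j \<and> k = l then of_nat (card (carrier G)) / of_nat n else 0)"
proof -
  let ?B = "mat_unit n n k l"
  define S where "S = msum n n (\<lambda>g. \<sigma> g * ?B * \<sigma> (inv g)) (carrier G)"
  have B: "?B \<in> carrier_mat n n" by (simp add: mat_unit_def)
  have Sc: "S \<in> carrier_mat n n" by (simp add: S_def)
  obtain c where c: "S = c \<cdot>\<^sub>m 1\<^sub>m n"
    using schur_scalar[OF irr \<sigma> Sc] schur_average[OF \<sigma> \<sigma> B] by (auto simp: S_def)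
  have trB: "mtrace ?B = (if k = l then 1 else 0)"
  proof -
    have "mtrace ?B = (\<Sum>i<n. if i = k then (if k = l then 1 else 0) else 0)"
      unfolding mtrace_def by (intro sum.cong) (auto simp: mat_unit_def)
    then show ?thesis using ij by simp
  qed
  \<comment> \<open>The scalar \<open>c\<close> is found from the trace: every summand is conjugate
    to \<open>?B\<close> and so has the trace of \<open>?B\<close>.\<close>
  have "mtrace S = (\<Sum>g\<in>carrier G. mtrace (\<sigma> g * ?B * \<sigma> (inv g)))"
    unfolding S_def
    by (rule mtrace_msum) (meson B inv_closed is_repD(1)[OF \<sigma>] mult_carrier_mat)
  also have "\<dots> = (\<Sum>g\<in>carrier G. mtrace ?B)"
  proof (rule sum.cong[OF refl])
    fix g assume g: "g \<in> carrier G"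
    note s = is_repD(1)[OF \<sigma> g] is_repD(1)[OF \<sigma> inv_closed[OF g]]
    have "mtrace (\<sigma> g * ?B * \<sigma> (inv g)) = mtrace (\<sigma> (inv g) * (\<sigma> g * ?B))"
      by (rule mtrace_mult_comm[OF mult_carrier_mat[OF s(1) B] s(2)])
    also have "\<sigma> (inv g) * (\<sigma> g * ?B) = ?B"
      using assoc_mult_mat[OF s(2,1) B] is_rep_inv(2)[OF \<sigma> g] B by simp
    finally show "mtrace (\<sigma> g * ?B * \<sigma> (inv g)) = mtrace ?B" .
  qed
  finally have trS: "mtrace S = of_nat (card (carrier G)) * (if k = l then 1 else 0)"
    using trB by simp
  have "mtrace S = of_nat n * c" unfolding c by (simp add: mtrace_def)
  then have cn: "c = (if k = l then of_nat (card (carrier G)) / of_nat n else 0)"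
    using trS ij by (auto simp: field_simps)
  have "(\<Sum>g\<in>carrier G. \<sigma> g $$ (i, k) * \<sigma> (inv g) $$ (l, j)) =
      (\<Sum>g\<in>carrier G. (\<sigma> g * ?B * \<sigma> (inv g)) $$ (i, j))"
    using ij by (intro sum.cong refl mult_mat_unit_mult[symmetric, OF is_repD(1)[OF \<sigma>] is_repD(1)[OF \<sigma> inv_closed]])
  also have "\<dots> = S $$ (i, j)" using ij by (simp add: S_def)
  also have "\<dots> = (if i = j then c else 0)" using ij by (simp add: c)
  finally show ?thesis using cn by simp
qed

section \<open>Characters\<close>

lemma chi_iso:
  assumes "rep_iso G \<rho> \<sigma>" "is_rep m \<rho>" "is_rep n \<sigma>" "g \<in> carrier G"
  shows "chi \<rho> g = chi \<sigma> g"
proof -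
  obtain P Q where P: "P \<in> carrier_mat n m" "Q \<in> carrier_mat m n"
    "P * Q = 1\<^sub>m n" "Q * P = 1\<^sub>m m" "P * \<rho> g = \<sigma> g * P"
    using assms(1,4) unfolding rep_iso_iff[OF assms(2,3)] by blast
  note c = is_repD(1)[OF assms(2,4)] is_repD(1)[OF assms(3,4)]
  have "mtrace (\<sigma> g) = mtrace (\<sigma> g * P * Q)"
    using assoc_mult_mat[OF c(2) P(1,2)] P(3) c by simp
  also have "\<dots> = mtrace (Q * (P * \<rho> g))"
    using mtrace_mult_comm[OF mult_carrier_mat[OF P(1) c(1)] P(2)] P(5) by simp
  also have "\<dots> = mtrace (\<rho> g)"
    using assoc_mult_mat[OF P(2,1) c(1)] P(4) c by simp
  finally show ?thesis by (simp add: chi_def)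
qed

lemma chi_iso':
  "rep_iso G \<rho> \<sigma> \<Longrightarrow> representation G \<rho> \<Longrightarrow> representation G \<sigma> \<Longrightarrow> g \<in> carrier G \<Longrightarrow> chi \<rho> g = chi \<sigma> g"
  using chi_iso representation_iff_is_rep by blast

lemma chi_direct_sum:
  assumes "\<forall>\<tau> \<in> set \<tau>s. representation G \<tau>" "g \<in> carrier G"
  shows "chi (direct_sum_rep \<tau>s) g = (\<Sum>\<tau>\<leftarrow>\<tau>s. chi \<tau> g)"
  using assms(1)
proof (induction \<tau>s)
  case Nil
  show ?case by (simp add: chi_def mtrace_def)
next
  case (Cons \<tau> \<tau>s)
  have r: "is_rep (rep_degree G \<tau>) \<tau>" "is_rep (rep_degree G (direct_sum_rep \<tau>s)) (direct_sum_rep \<tau>s)"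
    using Cons.prems representation_direct_sum[of \<tau>s] by (auto simp: representation_iff_is_rep[symmetric])
  show ?case
    using Cons mtrace_four_block[OF is_repD(1)[OF r(1) assms(2)] is_repD(1)[OF r(2) assms(2)]]
    by (simp add: direct_sum_rep_Cons chi_def dsum2_eq[OF r assms(2)])
qed

lemma chi_isotypic:
  assumes "\<And>j. j < length \<sigma>s \<Longrightarrow> representation G (\<sigma>s ! j)" "g \<in> carrier G"
  shows "chi (direct_sum_rep (concat (map (\<lambda>j. replicate (m j) (\<sigma>s ! j)) [0..<length \<sigma>s]))) g =
    (\<Sum>j<length \<sigma>s. of_nat (m j) * chi (\<sigma>s ! j) g)"
proof -
  have "(\<Sum>\<tau>\<leftarrow>concat (map (\<lambda>j. replicate (m j) (\<sigma>s ! j)) [0..<r]). chi \<tau> g) =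
    (\<Sum>j<r. of_nat (m j) * chi (\<sigma>s ! j) g)" for r
    by (induction r) (simp_all add: sum_list_replicate)
  moreover have "\<forall>\<tau> \<in> set (concat (map (\<lambda>j. replicate (m j) (\<sigma>s ! j)) [0..<length \<sigma>s])). representation G \<tau>"
    using assms(1) by auto
  ultimately show ?thesis using chi_direct_sum[OF _ assms(2)] by simp
qed

lemma is_rep_tensor:
  assumes "is_rep m \<rho>" "is_rep n \<sigma>"
  shows "is_rep (m * n) (tensor_rep \<rho> \<sigma>)"
proof -
  have "tensor_rep \<rho> \<sigma> (g \<otimes> h) = tensor_rep \<rho> \<sigma> g * tensor_rep \<rho> \<sigma> h"
    if "g \<in> carrier G" "h \<in> carrier G" for g h
    using kronecker_mult[OF is_repD(1)[OF assms(1) that(1)] is_repD(1)[OF assms(2) that(1)]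
        is_repD(1)[OF assms(1) that(2)] is_repD(1)[OF assms(2) that(2)]] that
    by (simp add: tensor_rep_def is_repD(3)[OF assms(1)] is_repD(3)[OF assms(2)])
  then show ?thesis
    using is_repD(1,2)[OF assms(1)] is_repD(1,2)[OF assms(2)]
    by (auto simp: is_rep_def tensor_rep_def kronecker_one)
qed

lemma chi_tensor:
  assumes "is_rep m \<rho>" "is_rep n \<sigma>" "g \<in> carrier G"
  shows "chi (tensor_rep \<rho> \<sigma>) g = chi \<rho> g * chi \<sigma> g"
  using mtrace_kronecker[OF is_repD(1)[OF assms(1,3)] is_repD(1)[OF assms(2,3)]]
  by (simp add: chi_def tensor_rep_def)

lemma chi_one: "is_rep n \<rho> \<Longrightarrow> chi \<rho> \<one> = of_nat n"
  by (simp add: chi_def is_repD(2))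

lemma chi_conjugate:
  assumes \<rho>: "is_rep n \<rho>" and g: "g \<in> carrier G" and h: "h \<in> carrier G"
  shows "chi \<rho> (g \<otimes> h \<otimes> inv g) = chi \<rho> h"
proof -
  note c = is_repD(1)[OF \<rho> g] is_repD(1)[OF \<rho> h] is_repD(1)[OF \<rho> inv_closed[OF g]]
  have "mtrace (\<rho> g * \<rho> h * \<rho> (inv g)) = mtrace (\<rho> (inv g) * (\<rho> g * \<rho> h))"
    by (rule mtrace_mult_comm[OF mult_carrier_mat[OF c(1,2)] c(3)])
  also have "\<rho> (inv g) * (\<rho> g * \<rho> h) = \<rho> h"
    using assoc_mult_mat[OF c(3,1,2)] is_rep_inv(2)[OF \<rho> g] c by simp
  finally show ?thesis using g h by (simp add: chi_def is_repD(3)[OF \<rho>])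
qed

text \<open>The value at \<open>inv g\<close> stands where the classical inner product of characters
  has a complex conjugate. The relation is the entrywise one summed over all pairs of diagonal
  entries.\<close>

lemma chi_orthogonality:
  assumes irr: "irreducible_rep G \<sigma>" "irreducible_rep G \<tau>"
  shows "(\<Sum>g\<in>carrier G. chi \<tau> g * chi \<sigma> (inv g)) =
    (if rep_iso G \<sigma> \<tau> then of_nat (card (carrier G)) else 0)"
proof -
  obtain m n where \<sigma>: "is_rep m \<sigma>" and \<tau>: "is_rep n \<tau>" and m: "m \<noteq> 0"
    using irr irreducible_repE by metis
  have expand: "(\<Sum>g\<in>carrier G. chi \<alpha> g * chi \<beta> (inv g)) =
      (\<Sum>i<a. \<Sum>j<b. \<Sum>g\<in>carrier G. \<alpha> g $$ (i, i) * \<beta> (inv g) $$ (j, j))"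
    if "is_rep a \<alpha>" "is_rep b \<beta>" for a b \<alpha> \<beta>
  proof -
    have "(\<Sum>g\<in>carrier G. chi \<alpha> g * chi \<beta> (inv g)) =
      (\<Sum>g\<in>carrier G. \<Sum>i<a. \<Sum>j<b. \<alpha> g $$ (i, i) * \<beta> (inv g) $$ (j, j))"
      using carrier_matD(1)[OF is_repD(1)[OF that(1)]]
        carrier_matD(1)[OF is_repD(1)[OF that(2) inv_closed]]
      by (intro sum.cong refl) (simp add: chi_def mtrace_def sum_product)
    also have "\<dots> = (\<Sum>i<a. \<Sum>g\<in>carrier G. \<Sum>j<b. \<alpha> g $$ (i, i) * \<beta> (inv g) $$ (j, j))"
      by (rule sum.swap)
    also have "\<dots> = (\<Sum>i<a. \<Sum>j<b. \<Sum>g\<in>carrier G. \<alpha> g $$ (i, i) * \<beta> (inv g) $$ (j, j))"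
      by (intro sum.cong refl sum.swap)
    finally show ?thesis .
  qed
  show ?thesis
  proof (cases "rep_iso G \<sigma> \<tau>")
    case False
    then show ?thesis
      using schur_orthogonality_noniso[OF irr \<sigma> \<tau>] by (simp add: expand[OF \<tau> \<sigma>])
  next
    case True
    have "(\<Sum>g\<in>carrier G. chi \<tau> g * chi \<sigma> (inv g)) = (\<Sum>g\<in>carrier G. chi \<sigma> g * chi \<sigma> (inv g))"
      using chi_iso[OF True \<sigma> \<tau>] by simp
    also have "\<dots> = (\<Sum>i<m. \<Sum>j<m. if i = j then of_nat (card (carrier G)) / of_nat m else 0)"
      unfolding expand[OF \<sigma> \<sigma>]
      by (intro sum.cong refl) (simp add: schur_orthogonality_iso[OF irr(1) \<sigma>])
    also have "\<dots> = of_nat (card (carrier G))" using m by simp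
    finally show ?thesis using True by simp
  qed
qed

lemma complete_irreps_orthogonality:
  assumes "complete_irreps G \<sigma>s" "i < length \<sigma>s" "j < length \<sigma>s"
  shows "(\<Sum>g\<in>carrier G. chi (\<sigma>s ! i) g * chi (\<sigma>s ! j) (inv g)) =
    (if i = j then of_nat (card (carrier G)) else 0)"
proof -
  have irr: "irreducible_rep G (\<sigma>s ! i)" "irreducible_rep G (\<sigma>s ! j)"
    using assms by (auto simp: complete_irreps_def)
  have "rep_iso G (\<sigma>s ! j) (\<sigma>s ! i) \<longleftrightarrow> i = j"
    using assms irreducible_repD(1)[OF irr(1)] by (auto simp: complete_irreps_def)
  then show ?thesis using chi_orthogonality[OF irr(2,1)] by simp
qed

lemma card_carrier_nonzero [simp]: "of_nat (card (carrier G)) \<noteq> (0 :: complex)"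
  using one_closed by (auto simp: card_eq_0_iff)

text \<open>This unlocks the definite description: the rows come from decomposing the tensor
  products, and the characters leave only one choice for each entry. The second claim says that the
  column of the character table at \<open>g\<close> is an eigenvector for
  \<open>chi \<rho> g\<close>.\<close>

lemma mckay_matrix_properties:
  assumes \<rho>: "representation G \<rho>" and \<sigma>s: "complete_irreps G \<sigma>s"
  shows "mckay_matrix G \<rho> \<sigma>s \<in> carrier_mat (length \<sigma>s) (length \<sigma>s)" (is ?A)
    and "i < length \<sigma>s \<Longrightarrow> g \<in> carrier G \<Longrightarrow>
      (\<Sum>j<length \<sigma>s. of_nat (mckay_matrix G \<rho> \<sigma>s $$ (i, j)) * chi (\<sigma>s ! j) g) =
      chi \<rho> g * chi (\<sigma>s ! i) g" (is "_ \<Longrightarrow> _ \<Longrightarrow> ?B")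
proof -
  let ?r = "length \<sigma>s"
  let ?D = "\<lambda>m. direct_sum_rep (concat (map (\<lambda>j. replicate (m j) (\<sigma>s ! j)) [0..<?r]))"
  define good where "good A \<longleftrightarrow> A \<in> carrier_mat ?r ?r \<and>
    (\<forall>i < ?r. rep_iso G (tensor_rep \<rho> (\<sigma>s ! i)) (?D (\<lambda>j. A $$ (i, j))))" for A :: "nat mat"
  have rep: "representation G (\<sigma>s ! i)" if "i < ?r" for i
    using \<sigma>s that irreducible_repD(1) by (auto simp: complete_irreps_def)
  have ten: "representation G (tensor_rep \<rho> (\<sigma>s ! i))" if "i < ?r" for i
    using rep[OF that] \<rho> is_rep_tensor is_rep_imp_representation representation_iff_is_rep by metis
  have D: "representation G (?D m)" for m
    using rep by (intro representation_direct_sum) auto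
  have eq: "(\<Sum>j<?r. of_nat (A $$ (i, j)) * chi (\<sigma>s ! j) g) = chi \<rho> g * chi (\<sigma>s ! i) g"
    if "good A" "i < ?r" "g \<in> carrier G" for A i g
  proof -
    have "chi \<rho> g * chi (\<sigma>s ! i) g = chi (tensor_rep \<rho> (\<sigma>s ! i)) g"
      using chi_tensor[of _ \<rho> _ "\<sigma>s ! i" g] \<rho> rep[OF that(2)] that(3) representation_iff_is_rep by metis
    also have "\<dots> = chi (?D (\<lambda>j. A $$ (i, j))) g"
      using that ten[OF that(2)] D by (intro chi_iso') (auto simp: good_def)
    also have "\<dots> = (\<Sum>j<?r. of_nat (A $$ (i, j)) * chi (\<sigma>s ! j) g)"
      using rep that(3) by (rule chi_isotypic)
    finally show ?thesis ..
  qed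
  \<comment> \<open>Pairing with the \<open>k\<close>-th character isolates one entry. The
    right-hand side does not mention \<open>A\<close>, so two solutions agree.\<close>
  have entry: "of_nat (A $$ (i, k)) * of_nat (card (carrier G)) =
      (\<Sum>g\<in>carrier G. chi \<rho> g * chi (\<sigma>s ! i) g * chi (\<sigma>s ! k) (inv g))"
    if "good A" "i < ?r" "k < ?r" for A i k
  proof -
    have "(\<Sum>g\<in>carrier G. chi \<rho> g * chi (\<sigma>s ! i) g * chi (\<sigma>s ! k) (inv g)) =
      (\<Sum>g\<in>carrier G. \<Sum>j<?r. of_nat (A $$ (i, j)) * (chi (\<sigma>s ! j) g * chi (\<sigma>s ! k) (inv g)))"
      using eq[OF that(1,2)] by (intro sum.cong refl) (simp add: sum_distrib_right mult.assoc flip: eq[OF that(1,2)])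
    also have "\<dots> = (\<Sum>j<?r. of_nat (A $$ (i, j)) *
        (\<Sum>g\<in>carrier G. chi (\<sigma>s ! j) g * chi (\<sigma>s ! k) (inv g)))"
      by (subst sum.swap) (simp add: sum_distrib_left)
    also have "\<dots> = (\<Sum>j<?r. if j = k then of_nat (A $$ (i, k)) * of_nat (card (carrier G)) else 0)"
      using that by (intro sum.cong refl) (simp add: complete_irreps_orthogonality[OF \<sigma>s])
    finally show ?thesis using that by simp
  qed
  have "\<forall>i. \<exists>m. i < ?r \<longrightarrow> rep_iso G (tensor_rep \<rho> (\<sigma>s ! i)) (?D m)"
    using isotypic_decomposition[OF \<sigma>s ten] by blast
  then obtain m where m: "\<And>i. i < ?r \<Longrightarrow> rep_iso G (tensor_rep \<rho> (\<sigma>s ! i)) (?D (m i))" by metis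
  have "good (mat ?r ?r (\<lambda>(i, j). m i j))"
  proof -
    have "concat (map (\<lambda>j. replicate (mat ?r ?r (\<lambda>(i, j). m i j) $$ (i, j)) (\<sigma>s ! j)) [0..<?r]) =
      concat (map (\<lambda>j. replicate (m i j) (\<sigma>s ! j)) [0..<?r])" if "i < ?r" for i
      using that by (intro arg_cong[of _ _ concat] map_cong) auto
    then show ?thesis using m by (simp add: good_def)
  qed
  moreover have "A = B" if "good A" "good B" for A B
  proof (rule eq_matI)
    fix i j assume "i < dim_row B" "j < dim_col B"
    then have ij: "i < ?r" "j < ?r" using that by (auto simp: good_def)
    have "(of_nat (A $$ (i, j)) :: complex) = of_nat (B $$ (i, j))"
      using entry[OF that(1) ij] entry[OF that(2) ij] card_carrier_nonzero by (metis mult_right_cancel)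
    then show "A $$ (i, j) = B $$ (i, j)" by simp
  qed (use that in \<open>auto simp: good_def\<close>)
  ultimately have "good (THE A. good A)" by (metis theI)
  then have g: "good (mckay_matrix G \<rho> \<sigma>s)" by (simp add: mckay_matrix_def good_def)
  then show ?A by (simp add: good_def)
  show "i < ?r \<Longrightarrow> g \<in> carrier G \<Longrightarrow> ?B" by (rule eq[OF g])
qed

end

context finite_group
begin

lemma mult_inv_cancel:
  assumes "x \<in> carrier G" "y \<in> carrier G"
  shows "x \<otimes> (inv x \<otimes> y) = y" "inv x \<otimes> (x \<otimes> y) = y"
  using assms by (simp_all add: m_assoc[symmetric])

section \<open>Column orthogonality\<close>

text \<open>
  For a class function \<open>f\<close>, the operator \<open>\<Sum>g. f g \<tau> (inv g)\<close> commutes with \<open>\<tau>\<close>. If \<open>f\<close> is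
  orthogonal to all irreducible characters, Schur's lemma makes it vanish for irreducible \<open>\<tau>\<close>,
  hence for all \<open>\<tau>\<close>; for the regular representation this means \<open>f = 0\<close>.
\<close>

definition fourier :: "('g \<Rightarrow> complex) \<Rightarrow> nat \<Rightarrow> ('g \<Rightarrow> complex mat) \<Rightarrow> complex mat" where
  "fourier f n \<tau> = msum n n (\<lambda>g. f g \<cdot>\<^sub>m \<tau> (inv g)) (carrier G)"

lemma fourier_carrier [simp]: "fourier f n \<tau> \<in> carrier_mat n n"
  by (simp add: fourier_def)

lemma fourier_irreducible_eq_zero:
  assumes irr: "irreducible_rep G \<sigma>" and \<sigma>: "is_rep n \<sigma>"
    and cf: "\<And>g h. g \<in> carrier G \<Longrightarrow> h \<in> carrier G \<Longrightarrow> f (g \<otimes> h \<otimes> inv g) = f h"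
    and orth: "(\<Sum>g\<in>carrier G. f g * chi \<sigma> (inv g)) = 0"
  shows "fourier f n \<sigma> = 0\<^sub>m n n"
proof -
  note c = is_repD(1)[OF \<sigma>]
  have "fourier f n \<sigma> * \<sigma> h = \<sigma> h * fourier f n \<sigma>" if h: "h \<in> carrier G" for h
  proof -
    have "fourier f n \<sigma> * \<sigma> h = msum n n (\<lambda>g. f g \<cdot>\<^sub>m \<sigma> (inv g) * \<sigma> h) (carrier G)"
      unfolding fourier_def by (rule msum_mult[OF c[OF h]]) (simp add: c)
    also have "\<dots> = msum n n (\<lambda>g. f (h \<otimes> g \<otimes> inv h) \<cdot>\<^sub>m \<sigma> (inv (h \<otimes> g \<otimes> inv h)) * \<sigma> h) (carrier G)"
    proof (rule msum_reindex[symmetric])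
      show "bij_betw (\<lambda>g. h \<otimes> g \<otimes> inv h) (carrier G) (carrier G)"
        using h by (intro bij_betw_byWitness[where f' = "\<lambda>g. inv h \<otimes> g \<otimes> h"])
          (auto simp: m_assoc mult_inv_cancel)
    qed
    also have "\<dots> = msum n n (\<lambda>g. \<sigma> h * (f g \<cdot>\<^sub>m \<sigma> (inv g))) (carrier G)"
    proof (rule msum_cong)
      fix g assume g: "g \<in> carrier G"
      have hg: "h \<otimes> g \<otimes> inv h \<in> carrier G" using g h by simp
      have "\<sigma> (inv (h \<otimes> g \<otimes> inv h)) * \<sigma> h = \<sigma> h * \<sigma> (inv g)"
        using g h by (simp add: is_repD(3)[OF \<sigma>, symmetric] inv_mult_group m_assoc)
      then show "f (h \<otimes> g \<otimes> inv h) \<cdot>\<^sub>m \<sigma> (inv (h \<otimes> g \<otimes> inv h)) * \<sigma> h = \<sigma> h * (f g \<cdot>\<^sub>m \<sigma> (inv g))"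
        unfolding cf[OF h g] mult_smult_assoc_mat[OF c[OF inv_closed[OF hg]] c[OF h]]
          mult_smult_distrib[OF c[OF h] c[OF inv_closed[OF g]]] by simp
    qed
    also have "\<dots> = \<sigma> h * fourier f n \<sigma>"
      unfolding fourier_def by (rule mult_msum[OF c[OF h], symmetric]) (simp add: c)
    finally show ?thesis .
  qed
  then obtain a where a: "fourier f n \<sigma> = a \<cdot>\<^sub>m 1\<^sub>m n"
    using schur_scalar[OF irr \<sigma> fourier_carrier] by blast
  \<comment> \<open>The scalar \<open>a\<close> is read off from the trace, which is the pairing of
    \<open>f\<close> with the character of \<open>\<sigma>\<close> and vanishes by
    assumption.\<close>
  have "mtrace (fourier f n \<sigma>) = (\<Sum>g\<in>carrier G. mtrace (f g \<cdot>\<^sub>m \<sigma> (inv g)))"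
    unfolding fourier_def by (rule mtrace_msum) (simp add: c)
  also have "\<dots> = (\<Sum>g\<in>carrier G. f g * chi \<sigma> (inv g))"
    using carrier_matD[OF c[OF inv_closed]]
    by (intro sum.cong refl) (simp add: mtrace_def chi_def sum_distrib_left)
  finally have "of_nat n * a = 0" using orth unfolding a by (simp add: mtrace_def)
  moreover have "n \<noteq> 0" using irr irreducible_repD(2) is_rep_degree[OF \<sigma>] by auto
  ultimately show ?thesis unfolding a by (auto intro!: eq_matI)
qed

lemma fourier_iso_eq_zero:
  assumes iso: "rep_iso G \<rho> \<sigma>" and \<rho>: "is_rep m \<rho>" and \<sigma>: "is_rep n \<sigma>"
    and z: "fourier f n \<sigma> = 0\<^sub>m n n"
  shows "fourier f m \<rho> = 0\<^sub>m m m"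
proof -
  obtain P Q where P: "P \<in> carrier_mat n m" "Q \<in> carrier_mat m n"
    "P * Q = 1\<^sub>m n" "Q * P = 1\<^sub>m m" "\<And>g. g \<in> carrier G \<Longrightarrow> P * \<rho> g = \<sigma> g * P"
    using iso unfolding rep_iso_iff[OF \<rho> \<sigma>] by blast
  note c = is_repD(1)[OF \<rho> inv_closed] is_repD(1)[OF \<sigma> inv_closed]
  have "P * fourier f m \<rho> = msum n m (\<lambda>g. P * (f g \<cdot>\<^sub>m \<rho> (inv g))) (carrier G)"
    unfolding fourier_def by (rule mult_msum[OF P(1)]) (simp add: c)
  also have "\<dots> = msum n m (\<lambda>g. f g \<cdot>\<^sub>m \<sigma> (inv g) * P) (carrier G)"
    using P(5)[OF inv_closed] mult_smult_assoc_mat[OF c(2) P(1)] mult_smult_distrib[OF P(1) c(1)]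
    by (intro msum_cong) simp
  also have "\<dots> = fourier f n \<sigma> * P"
    unfolding fourier_def by (rule msum_mult[OF P(1), symmetric]) (simp add: c)
  also have "\<dots> = 0\<^sub>m n m" unfolding z using P(1) by simp
  finally have Pz: "P * fourier f m \<rho> = 0\<^sub>m n m" .
  have "fourier f m \<rho> = Q * P * fourier f m \<rho>" unfolding P(4) left_mult_one_mat[OF fourier_carrier] ..
  also have "\<dots> = Q * (P * fourier f m \<rho>)" by (rule assoc_mult_mat[OF P(2,1) fourier_carrier])
  also have "\<dots> = 0\<^sub>m m m" unfolding Pz using P(2) by simp
  finally show ?thesis .
qed

lemma fourier_dsum2:
  assumes "is_rep m \<alpha>" "is_rep n \<beta>"
  shows "fourier f (m + n) (dsum2 \<alpha> \<beta>) =
    four_block_mat (fourier f m \<alpha>) (0\<^sub>m m n) (0\<^sub>m n m) (fourier f n \<beta>)"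
  using carrier_matD[OF is_repD(1)[OF assms(1) inv_closed]]
    carrier_matD[OF is_repD(1)[OF assms(2) inv_closed]]
  by (intro eq_matI) (auto simp: fourier_def dsum2_eq[OF assms])

lemma fourier_eq_zero:
  assumes cf: "\<And>g h. g \<in> carrier G \<Longrightarrow> h \<in> carrier G \<Longrightarrow> f (g \<otimes> h \<otimes> inv g) = f h"
    and orth: "\<And>\<sigma>. irreducible_rep G \<sigma> \<Longrightarrow> (\<Sum>g\<in>carrier G. f g * chi \<sigma> (inv g)) = 0"
    and \<tau>: "is_rep n \<tau>"
  shows "fourier f n \<tau> = 0\<^sub>m n n"
proof -
  have ds: "is_rep k (direct_sum_rep \<sigma>s) \<Longrightarrow> fourier f k (direct_sum_rep \<sigma>s) = 0\<^sub>m k k"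
    if "\<forall>\<sigma> \<in> set \<sigma>s. irreducible_rep G \<sigma>" for \<sigma>s k
    using that
  proof (induction \<sigma>s arbitrary: k)
    case Nil
    from Nil(1) have "is_rep k (\<lambda>g. 0\<^sub>m 0 0)" by simp
    from is_rep_degree[OF this] have "k = 0" using is_rep_degree[OF is_rep_zero] by simp
    then show ?case by (auto simp: fourier_def intro!: eq_matI)
  next
    case (Cons \<sigma> \<sigma>s)
    then have r: "representation G \<sigma>" "representation G (direct_sum_rep \<sigma>s)"
      using irreducible_repD(1) by (auto intro!: representation_direct_sum)
    then obtain a b where ab: "is_rep a \<sigma>" "is_rep b (direct_sum_rep \<sigma>s)"
      using representation_iff_is_rep by blast
    have k: "k = a + b"
      using is_rep_degree[OF Cons.prems(1)] is_rep_degree[OF is_rep_dsum2[OF ab]]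
      by (simp add: direct_sum_rep_Cons)
    have irr: "irreducible_rep G \<sigma>" using Cons.prems by simp
    have "fourier f a \<sigma> = 0\<^sub>m a a"
      by (rule fourier_irreducible_eq_zero[OF irr ab(1) cf orth[OF irr]])
    moreover have "fourier f b (direct_sum_rep \<sigma>s) = 0\<^sub>m b b"
      using Cons.IH[OF ab(2)] Cons.prems by simp
    ultimately show ?case
      by (simp add: direct_sum_rep_Cons k fourier_dsum2[OF ab])
  qed
  have rt: "representation G \<tau>" using \<tau> by (rule is_rep_imp_representation)
  obtain \<sigma>s where \<sigma>s: "\<forall>\<sigma> \<in> set \<sigma>s. irreducible_rep G \<sigma>" "rep_iso G \<tau> (direct_sum_rep \<sigma>s)"
    using completely_reducible[OF rt] by blast
  then have "representation G (direct_sum_rep \<sigma>s)"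
    using irreducible_repD(1) by (auto intro!: representation_direct_sum)
  then obtain k where k: "is_rep k (direct_sum_rep \<sigma>s)" using representation_iff_is_rep by blast
  show ?thesis by (rule fourier_iso_eq_zero[OF \<sigma>s(2) \<tau> k ds[OF \<sigma>s(1) k]])
qed

lemma class_function_eq_zero:
  assumes cf: "\<And>g h. g \<in> carrier G \<Longrightarrow> h \<in> carrier G \<Longrightarrow> f (g \<otimes> h \<otimes> inv g) = f h"
    and orth: "\<And>\<sigma>. irreducible_rep G \<sigma> \<Longrightarrow> (\<Sum>g\<in>carrier G. f g * chi \<sigma> (inv g)) = 0"
    and x: "x \<in> carrier G"
  shows "f x = 0"
proof -
  let ?N = "card (carrier G)"
  obtain e where e: "bij_betw e {..<?N} (carrier G)"
    using ex_bij_betw_nat_finite[OF finite_carrier] by (auto simp: atLeast0LessThan)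
  have ec: "e i \<in> carrier G" if "i < ?N" for i using e that by (auto simp: bij_betw_def)
  have inj: "e i = e j \<longleftrightarrow> i = j" if "i < ?N" "j < ?N" for i j
    using e that by (auto simp: bij_betw_def inj_on_def)
  have ex: "\<exists>i<?N. e i = g" if "g \<in> carrier G" for g
    using that bij_betw_imp_surj_on[OF e] by (metis imageE lessThan_iff)
  \<comment> \<open>The left regular representation, with basis vectors enumerated by
    \<open>e\<close>.\<close>
  define R where "R g = mat ?N ?N (\<lambda>(i, j). if e i = g \<otimes> e j then 1 else (0 :: complex))" for g
  have R: "is_rep ?N R"
    unfolding is_rep_def
  proof (intro conjI ballI)
    show "R g \<in> carrier_mat ?N ?N" for g by (simp add: R_def)
    show "R \<one> = 1\<^sub>m ?N" using ec inj by (auto simp: R_def intro!: eq_matI)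
    fix g h assume g: "g \<in> carrier G" and h: "h \<in> carrier G"
    show "R (g \<otimes> h) = R g * R h"
    proof (rule eq_matI)
      fix i j assume "i < dim_row (R g * R h)" "j < dim_col (R g * R h)"
      then have ij: "i < ?N" "j < ?N" by (auto simp: R_def)
      obtain k where k: "k < ?N" "e k = h \<otimes> e j" using ex[of "h \<otimes> e j"] h ec[OF ij(2)] by auto
      have "(R g * R h) $$ (i, j) = (\<Sum>l<?N. R g $$ (i, l) * R h $$ (l, j))"
        by (rule index_mult_mat_sum[of _ ?N ?N _ ?N]) (use ij in \<open>auto simp: R_def\<close>)
      also have "\<dots> = (\<Sum>l<?N. if l = k then R g $$ (i, k) else 0)"
        using ij k inj[OF _ k(1)] by (intro sum.cong refl) (auto simp: R_def)
      also have "\<dots> = R g $$ (i, k)" using k by simp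
      also have "\<dots> = R (g \<otimes> h) $$ (i, j)"
        using ij k g h ec[OF ij(2)] by (simp add: R_def m_assoc)
      finally show "R (g \<otimes> h) $$ (i, j) = (R g * R h) $$ (i, j)" ..
    qed (auto simp: R_def)
  qed
  \<comment> \<open>Row \<open>inv x\<close> and column \<open>\<one>\<close> are chosen because
    that entry of \<open>R (inv g)\<close> is 1 exactly for \<open>g = x\<close>, so the entry of
    the operator is \<open>f x\<close>.\<close>
  obtain i where i: "i < ?N" "e i = inv x" using ex[of "inv x"] x by auto
  obtain j where j: "j < ?N" "e j = \<one>" using ex[of \<one>] by auto
  have "0 = fourier f ?N R $$ (i, j)"
    using fourier_eq_zero[OF cf orth R] i j by simp
  also have "\<dots> = (\<Sum>g\<in>carrier G. f g * (if inv x = inv g then 1 else 0))"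
    using i j by (simp add: fourier_def R_def)
  also have "\<dots> = (\<Sum>g\<in>carrier G. if g = x then f x else 0)"
    using x by (intro sum.cong refl) (auto dest: inv_inj[THEN inj_onD])
  also have "\<dots> = f x" using x by simp
  finally show ?thesis ..
qed

section \<open>Conjugacy classes and the second orthogonality relation\<close>

definition conj_class :: "'g \<Rightarrow> 'g set" where
  "conj_class g = (\<lambda>x. x \<otimes> g \<otimes> inv x) ` carrier G"

lemma conj_class_self: "g \<in> carrier G \<Longrightarrow> g \<in> conj_class g"
  unfolding conj_class_def by (rule image_eqI[of _ _ \<one>]) auto

lemma conj_class_subset: "g \<in> carrier G \<Longrightarrow> conj_class g \<subseteq> carrier G"
  by (auto simp: conj_class_def)

lemma conj_class_conjugate:
  assumes g: "g \<in> carrier G" and x: "x \<in> carrier G"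
  shows "conj_class (x \<otimes> g \<otimes> inv x) = conj_class g"
proof (intro equalityI subsetI)
  fix z assume "z \<in> conj_class (x \<otimes> g \<otimes> inv x)"
  then obtain y where y: "y \<in> carrier G" "z = y \<otimes> (x \<otimes> g \<otimes> inv x) \<otimes> inv y"
    by (auto simp: conj_class_def)
  then have "z = (y \<otimes> x) \<otimes> g \<otimes> inv (y \<otimes> x)"
    using g x by (simp add: m_assoc inv_mult_group)
  then show "z \<in> conj_class g"
    unfolding conj_class_def using m_closed[OF y(1) x] by (rule image_eqI)
next
  fix z assume "z \<in> conj_class g"
  then obtain y where y: "y \<in> carrier G" "z = y \<otimes> g \<otimes> inv y" by (auto simp: conj_class_def)
  then have "z = (y \<otimes> inv x) \<otimes> (x \<otimes> g \<otimes> inv x) \<otimes> inv (y \<otimes> inv x)"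
    using g x by (simp add: m_assoc inv_mult_group mult_inv_cancel)
  then show "z \<in> conj_class (x \<otimes> g \<otimes> inv x)"
    unfolding conj_class_def using m_closed[OF y(1) inv_closed[OF x]] by (rule image_eqI)
qed

lemma conj_class_eq:
  assumes "g \<in> carrier G" "h \<in> conj_class g" shows "conj_class h = conj_class g"
  using assms conj_class_conjugate by (auto simp: conj_class_def[of g])

lemma finite_conj_class [simp]: "finite (conj_class g)"
  by (simp add: conj_class_def)

text \<open>Both sides are class functions of \<open>h\<close>, and they have the same pairing with
  every irreducible character: \<open>card (carrier G)\<close> times its value at
  \<open>inv g\<close>. The right-hand side has this pairing because its constant cancels the size
  of the class. Their difference \<open>f\<close> vanishes by
  \<open>class_function_eq_zero\<close>.\<close>

lemma column_orthogonality:
  assumes \<sigma>s: "complete_irreps G \<sigma>s" and g: "g \<in> carrier G" and h: "h \<in> carrier G"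
  shows "(\<Sum>i<length \<sigma>s. chi (\<sigma>s ! i) (inv g) * chi (\<sigma>s ! i) h) =
    (if h \<in> conj_class g then of_nat (card (carrier G)) / of_nat (card (conj_class g)) else 0)"
proof -
  let ?r = "length \<sigma>s" and ?c = "of_nat (card (carrier G)) / of_nat (card (conj_class g)) :: complex"
  have c0: "card (conj_class g) \<noteq> 0" using conj_class_self[OF g] by (auto simp: card_eq_0_iff)
  define f where "f h = (if h \<in> conj_class g then ?c else 0) -
    (\<Sum>i<?r. chi (\<sigma>s ! i) (inv g) * chi (\<sigma>s ! i) h)" for h
  have irr: "irreducible_rep G (\<sigma>s ! i)" if "i < ?r" for i
    using \<sigma>s that by (auto simp: complete_irreps_def)
  then have rep: "representation G (\<sigma>s ! i)" if "i < ?r" for i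
    using that irreducible_repD(1) by blast
  have "f h = 0"
  proof (rule class_function_eq_zero[OF _ _ h])
    fix x y assume x: "x \<in> carrier G" and y: "y \<in> carrier G"
    have "x \<otimes> y \<otimes> inv x \<in> conj_class g \<longleftrightarrow> y \<in> conj_class g"
      using conj_class_eq[OF g] conj_class_conjugate[OF y x] conj_class_self x y
      by (metis inv_closed m_closed)
    moreover have "chi (\<sigma>s ! i) (x \<otimes> y \<otimes> inv x) = chi (\<sigma>s ! i) y" if "i < ?r" for i
      using chi_conjugate[OF _ x y] rep[OF that] representation_iff_is_rep by blast
    ultimately show "f (x \<otimes> y \<otimes> inv x) = f y" by (simp add: f_def)
  next
    fix \<sigma> assume "irreducible_rep G \<sigma>"
    then obtain k where k: "k < ?r" "rep_iso G \<sigma> (\<sigma>s ! k)" and r: "representation G \<sigma>"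
      using \<sigma>s irreducible_repD(1) by (auto simp: complete_irreps_def)
    let ?\<kappa> = "\<sigma>s ! k"
    have conj: "chi ?\<kappa> (inv x) = chi ?\<kappa> (inv g)" if x: "x \<in> conj_class g" for x
    proof -
      obtain y where y: "y \<in> carrier G" "x = y \<otimes> g \<otimes> inv y" using x by (auto simp: conj_class_def)
      have "inv x = y \<otimes> inv g \<otimes> inv y" using y g by (simp add: inv_mult_group m_assoc)
      then show ?thesis
        using chi_conjugate[OF _ y(1) inv_closed[OF g]] rep[OF k(1)] representation_iff_is_rep by metis
    qed
    have "(\<Sum>x\<in>carrier G. f x * chi \<sigma> (inv x)) = (\<Sum>x\<in>carrier G. f x * chi ?\<kappa> (inv x))"
      using chi_iso'[OF k(2) r rep[OF k(1)]] by simp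
    also have "\<dots> = (\<Sum>x\<in>carrier G. (if x \<in> conj_class g then ?c * chi ?\<kappa> (inv x) else 0)) -
      (\<Sum>x\<in>carrier G. \<Sum>i<?r. chi (\<sigma>s ! i) (inv g) * (chi (\<sigma>s ! i) x * chi ?\<kappa> (inv x)))"
      unfolding sum_subtractf[symmetric]
      by (intro sum.cong refl) (auto simp: f_def left_diff_distrib sum_distrib_right mult.assoc)
    also have "(\<Sum>x\<in>carrier G. (if x \<in> conj_class g then ?c * chi ?\<kappa> (inv x) else 0)) =
        (\<Sum>x\<in>conj_class g. ?c * chi ?\<kappa> (inv g))"
      using conj_class_subset[OF g] conj
      by (subst sum.inter_restrict[symmetric]) (auto simp: Int_absorb1)
    also have "\<dots> = of_nat (card (carrier G)) * chi ?\<kappa> (inv g)"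
      using c0 by simp
    also have "(\<Sum>x\<in>carrier G. \<Sum>i<?r. chi (\<sigma>s ! i) (inv g) * (chi (\<sigma>s ! i) x * chi ?\<kappa> (inv x))) =
      (\<Sum>i<?r. chi (\<sigma>s ! i) (inv g) * (\<Sum>x\<in>carrier G. chi (\<sigma>s ! i) x * chi ?\<kappa> (inv x)))"
      by (subst sum.swap) (simp add: sum_distrib_left)
    also have "\<dots> = (\<Sum>i<?r. if i = k then chi ?\<kappa> (inv g) * of_nat (card (carrier G)) else 0)"
      using k by (intro sum.cong refl) (simp add: complete_irreps_orthogonality[OF \<sigma>s])
    also have "\<dots> = chi ?\<kappa> (inv g) * of_nat (card (carrier G))" using k by simp
    finally show "(\<Sum>x\<in>carrier G. f x * chi \<sigma> (inv x)) = 0" by simp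
  qed
  then show ?thesis by (simp add: f_def)
qed

section \<open>The kernel of a representation\<close>

text \<open>By Lagrange the order of the group is an exponent for \<open>\<rho> g\<close>, so
  \<open>finite_order_mtrace_eq_dim\<close> applies.\<close>

lemma chi_eq_degree_iff:
  assumes \<rho>: "is_rep n \<rho>" and g: "g \<in> carrier G"
  shows "chi \<rho> g = of_nat n \<longleftrightarrow> \<rho> g = 1\<^sub>m n"
proof
  assume tr: "chi \<rho> g = of_nat n"
  have pow: "\<rho> g ^\<^sub>m k = \<rho> (g [^] k)" for k :: nat
    using is_repD(1)[OF \<rho> g] by (induction k) (simp_all add: is_repD(2,3)[OF \<rho>] g)
  show "\<rho> g = 1\<^sub>m n"
  proof (rule finite_order_mtrace_eq_dim[OF is_repD(1)[OF \<rho> g]])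
    show "card (carrier G) > 0" using g by (auto simp: card_gt_0_iff)
    show "\<rho> g ^\<^sub>m card (carrier G) = 1\<^sub>m n"
      using pow_order_eq_1[OF g] by (simp add: pow is_repD(2)[OF \<rho>] Coset.order_def)
  qed (use tr in \<open>simp add: chi_def\<close>)
qed (simp add: chi_def)

lemma mem_kernel_iff:
  assumes \<rho>: "is_rep n \<rho>"
  shows "g \<in> kernel G (GL n) \<rho> \<longleftrightarrow> g \<in> carrier G \<and> chi \<rho> g = of_nat n"
  using chi_eq_degree_iff[OF \<rho>] by (auto simp: kernel_def GL_def units_of_def ring_mat_def)

lemma conj_classes_eq: "conj_classes G = conj_class ` carrier G"
  by (auto simp: conj_classes_def orbits_def orbit_def conj_class_def image_def)

text \<open>\<open>K\<close> is a union of classes, and the elements of one class \<open>C\<close>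
  contribute \<open>card C\<close> terms equal to \<open>1 / card C\<close>.\<close>

lemma card_conj_classes_eq_sum:
  assumes K: "K \<subseteq> carrier G" and closed: "\<And>g h. g \<in> carrier G \<Longrightarrow> h \<in> K \<Longrightarrow> g \<otimes> h \<otimes> inv g \<in> K"
  shows "of_nat (card {C \<in> conj_classes G. C \<subseteq> K}) =
    (\<Sum>g\<in>K. 1 / of_nat (card (conj_class g)) :: complex)"
proof -
  have finK: "finite K" by (rule finite_subset[OF K finite_carrier])
  have eq: "{C \<in> conj_classes G. C \<subseteq> K} = conj_class ` K"
  proof (intro equalityI subsetI)
    fix C assume "C \<in> {C \<in> conj_classes G. C \<subseteq> K}"
    then show "C \<in> conj_class ` K" using conj_class_self by (auto simp: conj_classes_eq)
  next
    fix C assume "C \<in> conj_class ` K"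
    then show "C \<in> {C \<in> conj_classes G. C \<subseteq> K}"
      using K closed by (auto simp: conj_classes_eq conj_class_def)
  qed
  have "(\<Sum>g\<in>K. 1 / of_nat (card (conj_class g)) :: complex) =
    (\<Sum>C\<in>conj_class ` K. \<Sum>g\<in>{g \<in> K. conj_class g = C}. 1 / of_nat (card (conj_class g)))"
    by (rule sum.group[symmetric]) (use finK in auto)
  also have "\<dots> = (\<Sum>C\<in>conj_class ` K. 1)"
  proof (rule sum.cong[OF refl])
    fix C assume "C \<in> conj_class ` K"
    then obtain h where h: "h \<in> K" "C = conj_class h" by auto
    have hG: "h \<in> carrier G" using h K by auto
    have "C \<subseteq> K" using h closed by (auto simp: conj_class_def)
    have "{g \<in> K. conj_class g = C} = C"
    proof (intro equalityI subsetI)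
      fix g assume "g \<in> {g \<in> K. conj_class g = C}"
      then show "g \<in> C" using K conj_class_self[of g] by blast
    next
      fix g assume "g \<in> C"
      then show "g \<in> {g \<in> K. conj_class g = C}"
        using \<open>C \<subseteq> K\<close> conj_class_eq[OF hG] h(2) by blast
    qed
    moreover have "card C \<noteq> 0" using h(2) conj_class_self[OF hG] by (auto simp: card_eq_0_iff)
    moreover have "conj_class g = C" if "g \<in> C" for g using that conj_class_eq[OF hG] h(2) by blast
    ultimately show "(\<Sum>g\<in>{g \<in> K. conj_class g = C}. 1 / of_nat (card (conj_class g)) :: complex) = 1"
      by simp
  qed
  finally show ?thesis by (simp add: eq)
qed

end

section \<open>Balanced weights on a finite digraph\<close>

text \<open>
  Weights \<open>w i j\<close> on the pairs of vertices \<open>i, j < r\<close> for which the flow out of and the flow into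
  each vertex \<open>i\<close> both equal \<open>n q i\<close>. For the McKay quiver, \<open>w i j = d i a i j d j\<close> and
  \<open>q i = (d i)\<^sup>2\<close> with \<open>d i\<close> the degree of the \<open>i\<close>-th irreducible representation.
\<close>

locale balanced_weights =
  fixes r :: nat and w :: "nat \<Rightarrow> nat \<Rightarrow> real" and q :: "nat \<Rightarrow> real" and n :: real
  assumes w_nonneg: "\<And>i j. i < r \<Longrightarrow> j < r \<Longrightarrow> w i j \<ge> 0"
    and q_pos: "\<And>i. i < r \<Longrightarrow> q i > 0"
    and outflow: "\<And>i. i < r \<Longrightarrow> (\<Sum>j<r. w i j) = n * q i"
    and inflow: "\<And>j. j < r \<Longrightarrow> (\<Sum>i<r. w i j) = n * q j"
begin

definition edges :: "(nat \<times> nat) set" where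
  "edges = {(i, j). i < r \<and> j < r \<and> w i j \<noteq> 0}"

text \<open>Only directed reachability from \<open>i\<close>; it becomes an equivalence class, hence
  a strong component, through \<open>reachable_sym\<close>.\<close>

definition comp :: "nat \<Rightarrow> nat set" where
  "comp i = {j. j < r \<and> (i, j) \<in> edges\<^sup>*}"

lemma finite_comp [simp]: "finite (comp i)"
  by (simp add: comp_def)

lemma comp_less: "j \<in> comp i \<Longrightarrow> j < r"
  by (simp add: comp_def)

lemma comp_self [simp]: "i < r \<Longrightarrow> i \<in> comp i"
  by (simp add: comp_def)

lemma comp_closed: "j \<in> comp i \<Longrightarrow> (j, k) \<in> edges \<Longrightarrow> k \<in> comp i"
  by (auto simp: comp_def intro: rtrancl_into_rtrancl) (simp add: edges_def)

text \<open>
  No flow leaves the set of vertices reachable from \<open>j\<close>, so by balance none enters it.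
\<close>

lemma edge_reverse_reachable:
  assumes "(i, j) \<in> edges" shows "i \<in> comp j"
proof (rule ccontr)
  assume i: "i \<notin> comp j"
  define S where "S = comp j"
  have ij: "i < r" "j < r" "w i j \<noteq> 0" using assms by (auto simp: edges_def)
  have S: "S \<subseteq> {..<r}" using comp_less by (auto simp: S_def)
  have fin: "finite S" by (simp add: S_def)
  have "(\<Sum>l\<in>S. \<Sum>k<r. w k l) = (\<Sum>k\<in>S. \<Sum>l<r. w k l)"
    using inflow outflow S by (simp add: subset_iff)
  also have "\<dots> = (\<Sum>k\<in>S. \<Sum>l\<in>S. w k l)"
  proof (rule sum.cong[OF refl], rule sum.mono_neutral_right)
    fix k assume k: "k \<in> S"
    show "\<forall>l\<in>{..<r} - S. w k l = 0"
      using k comp_closed[of k j] S unfolding S_def edges_def by auto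
  qed (use S in auto)
  also have "\<dots> = (\<Sum>l\<in>S. \<Sum>k\<in>S. w k l)" by (rule sum.swap)
  finally have into: "(\<Sum>l\<in>S. \<Sum>k\<in>{..<r} - S. w k l) = 0"
    using S by (simp add: sum_diff sum_subtractf)
  have nn: "\<And>l. l \<in> S \<Longrightarrow> (\<Sum>k\<in>{..<r} - S. w k l) \<ge> 0"
    using w_nonneg S by (intro sum_nonneg) auto
  have "j \<in> S" using ij by (simp add: S_def)
  then have "(\<Sum>k\<in>{..<r} - S. w k j) = 0"
    using into sum_nonneg_eq_0_iff[OF fin nn] by simp
  then have "\<forall>k\<in>{..<r} - S. w k j = 0"
    using w_nonneg ij by (subst (asm) sum_nonneg_eq_0_iff) auto
  with i ij show False by (auto simp: S_def)
qed

lemma reachable_sym: "(i, j) \<in> edges\<^sup>* \<Longrightarrow> (j, i) \<in> edges\<^sup>*"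
proof (induction rule: rtrancl_induct)
  case (step y z)
  have "(z, y) \<in> edges\<^sup>*" using edge_reverse_reachable[OF step(2)] by (simp add: comp_def)
  then show ?case using step(3) by (rule rtrancl_trans)
qed auto

lemma comp_eq:
  assumes "j \<in> comp i" shows "comp j = comp i"
proof -
  have "(i, j) \<in> edges\<^sup>*" "(j, i) \<in> edges\<^sup>*" using assms reachable_sym by (auto simp: comp_def)
  then show ?thesis by (auto simp: comp_def intro: rtrancl_trans)
qed

lemma edge_same_comp:
  assumes "(j, k) \<in> edges" shows "j \<in> comp i \<longleftrightarrow> k \<in> comp i"
proof
  assume k: "k \<in> comp i"
  have "j \<in> comp k" by (rule edge_reverse_reachable[OF assms])
  then show "j \<in> comp i" using comp_eq[OF k] by simp
qed (use comp_closed assms in blast)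

text \<open>The right-hand side is the trace of the operator \<open>average\<close> defined below;
  within one component the shares of \<open>q\<close> add up to 1.\<close>

lemma card_components_eq_sum:
  "real (card (comp ` {..<r})) = (\<Sum>i<r. q i / (\<Sum>k\<in>comp i. q k))"
proof -
  have "(\<Sum>i<r. q i / (\<Sum>k\<in>comp i. q k)) =
    (\<Sum>C\<in>comp ` {..<r}. \<Sum>i\<in>{i \<in> {..<r}. comp i = C}. q i / (\<Sum>k\<in>comp i. q k))"
    by (rule sum.group[symmetric]) auto
  also have "\<dots> = (\<Sum>C\<in>comp ` {..<r}. 1)"
  proof (rule sum.cong[OF refl])
    fix C assume "C \<in> comp ` {..<r}"
    then obtain j where j: "j < r" "C = comp j" by auto
    have eq: "{i \<in> {..<r}. comp i = C} = C"
      using j comp_less comp_eq comp_self by blast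
    have "(\<Sum>i\<in>{i \<in> {..<r}. comp i = C}. q i / (\<Sum>k\<in>comp i. q k)) = (\<Sum>i\<in>C. q i / (\<Sum>k\<in>C. q k))"
      unfolding eq using j comp_eq by (intro sum.cong refl) simp
    also have "\<dots> = 1"
    proof -
      have "(\<Sum>k\<in>C. q k) > 0"
        using comp_self[OF j(1)] comp_less q_pos j(2) by (intro sum_pos) auto
      then show ?thesis by (simp add: sum_divide_distrib[symmetric])
    qed
    finally show "(\<Sum>i\<in>{i \<in> {..<r}. comp i = C}. q i / (\<Sum>k\<in>comp i. q k)) = 1" .
  qed
  finally show ?thesis by simp
qed

text \<open>
  A harmonic function has vanishing Dirichlet energy \<open>\<Sum>i j. w i j \<bar>h i - h j\<bar>\<^sup>2\<close>.
\<close>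

lemma harmonic_eq_on_edge:
  fixes h :: "nat \<Rightarrow> complex"
  assumes harm: "\<And>i. i < r \<Longrightarrow> (\<Sum>j<r. of_real (w i j) * h j) = of_real (n * q i) * h i"
    and e: "(i, j) \<in> edges"
  shows "h i = h j"
proof -
  let ?w = "\<lambda>i j. of_real (w i j) :: complex"
  let ?T = "\<Sum>i<r. of_real (n * q i) * (h i * cnj (h i))"
  \<comment> \<open>Expanding the square in the energy gives four double sums, all equal to
    \<open>?T\<close>: the two pure ones by outflow and inflow, the mixed ones by harmonicity and
    its complex conjugate. They cancel.\<close>
  have 1: "(\<Sum>i<r. \<Sum>j<r. ?w i j * (h i * cnj (h i))) = ?T"
    by (simp add: sum_distrib_right[symmetric] of_real_sum[symmetric] outflow del: of_real_sum)
  have 2: "(\<Sum>i<r. \<Sum>j<r. ?w i j * (h j * cnj (h j))) = ?T"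
    by (subst sum.swap) (simp add: sum_distrib_right[symmetric] of_real_sum[symmetric] inflow del: of_real_sum)
  have 3: "(\<Sum>i<r. \<Sum>j<r. ?w i j * (h j * cnj (h i))) = ?T"
  proof (rule sum.cong[OF refl])
    fix i assume "i \<in> {..<r}"
    then show "(\<Sum>j<r. ?w i j * (h j * cnj (h i))) = of_real (n * q i) * (h i * cnj (h i))"
      using harm[of i] by (simp add: mult.assoc[symmetric] sum_distrib_right[symmetric])
  qed
  have 4: "(\<Sum>i<r. \<Sum>j<r. ?w i j * (h i * cnj (h j))) = ?T"
    using arg_cong[OF 3, of cnj] by (simp add: mult.commute)
  have "(\<Sum>i<r. \<Sum>j<r. of_real (w i j * (norm (h i - h j))\<^sup>2)) =
    (\<Sum>i<r. \<Sum>j<r. ?w i j * (h i * cnj (h i)) + ?w i j * (h j * cnj (h j))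
      - ?w i j * (h j * cnj (h i)) - ?w i j * (h i * cnj (h j)))"
    by (intro sum.cong refl)
      (simp only: of_real_mult complex_norm_square complex_cnj_diff, simp add: algebra_simps)
  also have "\<dots> = 0"
    by (simp only: sum.distrib sum_subtractf 1 2 3 4) simp
  finally have "of_real (\<Sum>i<r. \<Sum>j<r. w i j * (norm (h i - h j))\<^sup>2) = (0 :: complex)"
    by simp
  then have s0: "(\<Sum>i<r. \<Sum>j<r. w i j * (norm (h i - h j))\<^sup>2) = 0"
    using of_real_eq_0_iff by blast
  have ij: "i < r" "j < r" "w i j \<noteq> 0" using e by (auto simp: edges_def)
  have "(\<Sum>j<r. w i j * (norm (h i - h j))\<^sup>2) = 0"
    using s0 ij by (subst (asm) sum_nonneg_eq_0_iff) (auto intro!: sum_nonneg mult_nonneg_nonneg w_nonneg)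
  then have "w i j * (norm (h i - h j))\<^sup>2 = 0"
    using ij by (subst (asm) sum_nonneg_eq_0_iff) (auto intro!: mult_nonneg_nonneg w_nonneg)
  then show ?thesis using ij by simp
qed

definition average :: "(nat \<Rightarrow> complex) \<Rightarrow> nat \<Rightarrow> complex" where
  "average h i = (\<Sum>k\<in>comp i. of_real (q k) * h k) / of_real (\<Sum>k\<in>comp i. q k)"

text \<open>For \<open>c = n\<close> the function is harmonic, hence constant on each component.
  Otherwise let \<open>s\<close> be the weighted sum of \<open>h\<close> over a component. No edge
  joins it to the rest, so summing the equation over the component gives \<open>c * s\<close>, while
  the inflow condition gives \<open>n * s\<close>; thus \<open>s = 0\<close>.\<close>

lemma average_eigenvector:
  assumes eig: "\<And>i. i < r \<Longrightarrow> (\<Sum>j<r. of_real (w i j) * h j) = c * of_real (q i) * h i"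
    and i: "i < r"
  shows "average h i = (if c = of_real n then h i else 0)"
proof (cases "c = of_real n")
  case True
  have const: "h k = h i" if "k \<in> comp i" for k
  proof -
    have "(i, k) \<in> edges\<^sup>*" using that by (simp add: comp_def)
    then show ?thesis
    proof (induction rule: rtrancl_induct)
      case (step y z)
      have "h y = h z" by (rule harmonic_eq_on_edge[OF _ step(2)]) (simp add: eig True)
      with step show ?case by simp
    qed simp
  qed
  have "(\<Sum>k\<in>comp i. q k) > 0"
    using comp_self[OF i] comp_less q_pos by (intro sum_pos) auto
  then have "(of_real (\<Sum>k\<in>comp i. q k) :: complex) \<noteq> 0"
    using of_real_eq_0_iff by (metis less_irrefl)
  moreover have "(\<Sum>k\<in>comp i. of_real (q k) * h k) = of_real (\<Sum>k\<in>comp i. q k) * h i"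
    using const by (simp add: sum_distrib_right)
  ultimately show ?thesis using True by (simp add: average_def)
next
  case False
  have sub: "comp i \<subseteq> {..<r}" using comp_less by auto
  let ?s = "\<Sum>k\<in>comp i. of_real (q k) * h k"
  have "of_real n * ?s = (\<Sum>k\<in>comp i. of_real (\<Sum>j<r. w j k) * h k)"
    using inflow sub by (simp add: sum_distrib_left mult.assoc subset_iff del: of_real_sum)
  also have "\<dots> = (\<Sum>k\<in>comp i. \<Sum>j<r. of_real (w j k) * h k)"
    by (simp add: sum_distrib_right)
  also have "\<dots> = (\<Sum>k\<in>comp i. \<Sum>j\<in>comp i. of_real (w j k) * h k)"
  proof (rule sum.cong[OF refl], rule sum.mono_neutral_right)
    fix k assume k: "k \<in> comp i"
    show "\<forall>j\<in>{..<r} - comp i. of_real (w j k) * h k = 0"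
      using k edge_same_comp[of _ k i] comp_less[OF k] by (auto simp: edges_def)
  qed (use sub in auto)
  also have "\<dots> = (\<Sum>j\<in>comp i. \<Sum>k\<in>comp i. of_real (w j k) * h k)" by (rule sum.swap)
  also have "\<dots> = (\<Sum>j\<in>comp i. \<Sum>k<r. of_real (w j k) * h k)"
  proof (rule sum.cong[OF refl], rule sum.mono_neutral_left)
    fix j assume j: "j \<in> comp i"
    show "\<forall>k\<in>{..<r} - comp i. of_real (w j k) * h k = 0"
      using j edge_same_comp[of j _ i] comp_less[OF j] by (auto simp: edges_def)
  qed (use sub in auto)
  also have "\<dots> = c * ?s"
    using eig sub by (simp add: sum_distrib_left mult.assoc subset_iff)
  finally have "?s = 0" using False by simp
  then show ?thesis using False by (simp add: average_def)
qed

end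

section \<open>The components of the McKay quiver\<close>

lemma wf_digraph_mckay_quiver: "wf_digraph (mckay_quiver G \<rho> \<sigma>s)"
  by unfold_locales (auto simp: mckay_quiver_def)

lemma arcs_ends_mckay_quiver:
  "arcs_ends (mckay_quiver G \<rho> \<sigma>s) =
    {(i, j). i < length \<sigma>s \<and> j < length \<sigma>s \<and> mckay_matrix G \<rho> \<sigma>s $$ (i, j) \<noteq> 0}"
  by (auto simp: arcs_ends_def arc_to_ends_def mckay_quiver_def image_iff)

text \<open>The bounds are stated separately because the reflexive closure also contains pairs
  \<open>(i, i)\<close> with \<open>i\<close> not a vertex.\<close>

lemma reachable_mckay_quiver:
  "i \<rightarrow>\<^sup>*\<^bsub>mckay_quiver G \<rho> \<sigma>s\<^esub> j \<longleftrightarrow>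
    i < length \<sigma>s \<and> j < length \<sigma>s \<and> (i, j) \<in> (arcs_ends (mckay_quiver G \<rho> \<sigma>s))\<^sup>*"
    (is "_ \<rightarrow>\<^sup>*\<^bsub>?Q\<^esub> _ \<longleftrightarrow> _")
proof -
  interpret wf_digraph ?Q by (rule wf_digraph_mckay_quiver)
  have verts: "verts ?Q = {..<length \<sigma>s}" by (simp add: mckay_quiver_def)
  have "i \<rightarrow>\<^sup>*\<^bsub>?Q\<^esub> j" if "(i, j) \<in> (arcs_ends ?Q)\<^sup>*" "i < length \<sigma>s"
    using that
  proof (induction rule: rtrancl_induct)
    case base
    then show ?case using verts by auto
  next
    case (step y z)
    then show ?case using reachable_adj_trans[of i y z] by simp
  qed
  moreover have "i < length \<sigma>s \<and> j < length \<sigma>s \<and> (i, j) \<in> (arcs_ends ?Q)\<^sup>*" if "i \<rightarrow>\<^sup>*\<^bsub>?Q\<^esub> j"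
    using reachable_in_verts[OF that] reachable_rtranclI[OF that] by (simp add: verts)
  ultimately show ?thesis by auto
qed

context finite_group
begin

lemma conj_class_one [simp]: "conj_class \<one> = {\<one>}"
  by (auto simp: conj_class_def image_def)

text \<open>The row identity is the eigenvector equation at the identity element. The column
  identity compares coefficients of irreducible characters in \<open>chi \<rho>\<close> times the
  regular character, which is \<open>n\<close> times the regular character.\<close>

lemma mckay_matrix_balanced:
  assumes \<rho>: "is_rep n \<rho>" and \<sigma>s: "complete_irreps G \<sigma>s"
    and d: "\<And>i. i < length \<sigma>s \<Longrightarrow> is_rep (d i) (\<sigma>s ! i)"
  shows "i < length \<sigma>s \<Longrightarrow> (\<Sum>j<length \<sigma>s. mckay_matrix G \<rho> \<sigma>s $$ (i, j) * d j) = n * d i"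
    and "j < length \<sigma>s \<Longrightarrow> (\<Sum>i<length \<sigma>s. d i * mckay_matrix G \<rho> \<sigma>s $$ (i, j)) = n * d j"
proof -
  let ?r = "length \<sigma>s" and ?A = "\<lambda>i j. mckay_matrix G \<rho> \<sigma>s $$ (i, j)"
  have "representation G \<rho>" using \<rho> by (rule is_rep_imp_representation)
  note eig = mckay_matrix_properties(2)[OF this \<sigma>s]
  have d1: "chi (\<sigma>s ! i) \<one> = of_nat (d i)" if "i < ?r" for i by (rule chi_one[OF d[OF that]])
  show "(\<Sum>j<?r. ?A i j * d j) = n * d i" if i: "i < ?r"
  proof -
    have "(of_nat (\<Sum>j<?r. ?A i j * d j) :: complex) = of_nat (n * d i)"
      using eig[OF i one_closed] by (simp add: d1 i chi_one[OF \<rho>])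
    then show ?thesis by (rule of_nat_eq_iff[THEN iffD1])
  qed
  show "(\<Sum>i<?r. d i * ?A i j) = n * d j" if j: "j < ?r"
  proof -
    \<comment> \<open>Column orthogonality at \<open>\<one>\<close>, whose class is a singleton: the
      regular character.\<close>
    have reg: "(\<Sum>i<?r. of_nat (d i) * chi (\<sigma>s ! i) g) = (if g = \<one> then of_nat (card (carrier G)) else 0)"
      if g: "g \<in> carrier G" for g
      using column_orthogonality[OF \<sigma>s one_closed g] by (simp add: d1)
    \<comment> \<open>The differences of the coefficients in question. Their combination of
      characters vanishes on the group, and pairing with the \<open>j\<close>-th character extracts
      \<open>b j\<close>.\<close>
    define b where "b j = (\<Sum>i<?r. of_nat (d i * ?A i j)) - (of_nat (n * d j) :: complex)" for j
    have b: "(\<Sum>j<?r. b j * chi (\<sigma>s ! j) g) = 0" if g: "g \<in> carrier G" for g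
    proof -
      have "(\<Sum>j<?r. b j * chi (\<sigma>s ! j) g) =
        (\<Sum>j<?r. \<Sum>i<?r. of_nat (d i) * (of_nat (?A i j) * chi (\<sigma>s ! j) g)) -
        of_nat n * (\<Sum>j<?r. of_nat (d j) * chi (\<sigma>s ! j) g)"
        by (simp add: b_def left_diff_distrib sum_subtractf sum_distrib_left sum_distrib_right mult.assoc)
      also have "(\<Sum>j<?r. \<Sum>i<?r. of_nat (d i) * (of_nat (?A i j) * chi (\<sigma>s ! j) g)) =
        (\<Sum>i<?r. of_nat (d i) * (\<Sum>j<?r. of_nat (?A i j) * chi (\<sigma>s ! j) g))"
        by (subst sum.swap) (simp add: sum_distrib_left)
      also have "\<dots> = chi \<rho> g * (\<Sum>i<?r. of_nat (d i) * chi (\<sigma>s ! i) g)"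
        by (simp add: eig[OF _ g] sum_distrib_left mult.left_commute)
      finally show ?thesis
        by (auto simp: reg[OF g] chi_one[OF \<rho>] split: if_splits)
    qed
    have "0 = (\<Sum>g\<in>carrier G. (\<Sum>k<?r. b k * chi (\<sigma>s ! k) g) * chi (\<sigma>s ! j) (inv g))"
      by (simp add: b)
    also have "\<dots> = (\<Sum>k<?r. b k * (\<Sum>g\<in>carrier G. chi (\<sigma>s ! k) g * chi (\<sigma>s ! j) (inv g)))"
      by (simp add: sum_distrib_right sum_distrib_left mult.assoc, subst sum.swap, simp)
    also have "\<dots> = (\<Sum>k<?r. if k = j then b j * of_nat (card (carrier G)) else 0)"
      using j by (intro sum.cong refl) (simp add: complete_irreps_orthogonality[OF \<sigma>s])
    also have "\<dots> = b j * of_nat (card (carrier G))" using j by simp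
    finally have "b j = 0" using one_closed by auto
    then have "(of_nat (\<Sum>i<?r. d i * ?A i j) :: complex) = of_nat (n * d j)"
      by (simp only: b_def of_nat_sum) simp
    then show ?thesis by (rule of_nat_eq_iff[THEN iffD1])
  qed
qed

lemma card_sccs_mckay_quiver:
  assumes \<rho>: "is_rep n \<rho>" and \<sigma>s: "complete_irreps G \<sigma>s"
  shows "card (pre_digraph.sccs (mckay_quiver G \<rho> \<sigma>s)) =
    card {C \<in> conj_classes G. C \<subseteq> kernel G (GL n) \<rho>}"
proof -
  let ?r = "length \<sigma>s" and ?Q = "mckay_quiver G \<rho> \<sigma>s"
  let ?A = "\<lambda>i j. mckay_matrix G \<rho> \<sigma>s $$ (i, j)" and ?o = "of_nat (card (carrier G)) :: complex"
  have irr: "irreducible_rep G (\<sigma>s ! i)" if "i < ?r" for i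
    using \<sigma>s that by (auto simp: complete_irreps_def)
  define d where "d i = rep_degree G (\<sigma>s ! i)" for i
  have d: "is_rep (d i) (\<sigma>s ! i)" "d i \<noteq> 0" if "i < ?r" for i
    using irr[OF that] by (auto simp: d_def irreducible_rep_def representation_iff_is_rep)
  have balance: "i < ?r \<Longrightarrow> (\<Sum>j<?r. ?A i j * d j) = n * d i"
    "i < ?r \<Longrightarrow> (\<Sum>j<?r. d j * ?A j i) = n * d i" for i
    using mckay_matrix_balanced[OF \<rho> \<sigma>s, of d] d(1) by blast+
  have "representation G \<rho>" using \<rho> by (rule is_rep_imp_representation)
  note eig = mckay_matrix_properties(2)[OF this \<sigma>s]
  define w where "w i j = real (d i * ?A i j * d j)" for i j
  define q where "q i = real (d i * d i)" for i
  interpret balanced_weights ?r w q "real n"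
  proof
    fix i assume i: "i < ?r"
    show "0 < q i" using d(2)[OF i] by (simp add: q_def)
    have "(\<Sum>j<?r. d i * ?A i j * d j) = d i * (n * d i)"
      unfolding balance(1)[OF i, symmetric] by (simp add: sum_distrib_left mult.assoc)
    from arg_cong[OF this, of real] show "(\<Sum>j<?r. w i j) = real n * q i"
      by (simp add: w_def q_def mult.left_commute)
    have "(\<Sum>j<?r. d j * ?A j i * d i) = n * d i * d i"
      unfolding balance(2)[OF i, symmetric] by (simp add: sum_distrib_right)
    from arg_cong[OF this, of real] show "(\<Sum>j<?r. w j i) = real n * q i"
      by (simp add: w_def q_def mult.assoc)
  qed (simp add: w_def)
  have edges: "edges = arcs_ends ?Q"
    using d(2) by (auto simp: edges_def arcs_ends_mckay_quiver w_def)
  interpret quiver: wf_digraph ?Q by (rule wf_digraph_mckay_quiver)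
  \<comment> \<open>Mutual reachability reduces to reachability in one direction by
    \<open>reachable_sym\<close>.\<close>
  have "quiver.scc_of i = comp i" if "i < ?r" for i
    using that reachable_sym
    by (auto simp: quiver.scc_of_def reachable_mckay_quiver comp_def edges)
  then have "quiver.sccs_verts = comp ` {..<?r}"
    unfolding quiver.sccs_verts_conv_scc_of by (auto simp: mckay_quiver_def)
  then have sccs: "card quiver.sccs = card (comp ` {..<?r})"
    using quiver.card_sccs_verts by simp
  \<comment> \<open>Dividing by the degrees matches the weights: \<open>w i j * h g j\<close> is
    \<open>d i * ?A i j\<close> times the character value, so an eigenvector of the McKay matrix
    becomes one for \<open>w\<close> relative to \<open>q\<close>. The column at an element of the
    kernel becomes a harmonic function.\<close>
  define h where "h g i = chi (\<sigma>s ! i) g / of_nat (d i)" for g i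
  define K where "K = kernel G (GL n) \<rho>"
  have K: "g \<in> K \<longleftrightarrow> g \<in> carrier G \<and> chi \<rho> g = of_nat n" for g
    unfolding K_def by (rule mem_kernel_iff[OF \<rho>])
  have avg: "of_nat (d i) * average (h g) i = (if g \<in> K then chi (\<sigma>s ! i) g else 0)"
    if g: "g \<in> carrier G" and i: "i < ?r" for g i
  proof -
    have "average (h g) i = (if chi \<rho> g = of_real (real n) then h g i else 0)"
    proof (rule average_eigenvector[OF _ i])
      fix i assume i: "i < ?r"
      have "(\<Sum>j<?r. of_real (w i j) * h g j) =
          of_nat (d i) * (\<Sum>j<?r. of_nat (?A i j) * chi (\<sigma>s ! j) g)"
        unfolding sum_distrib_left using d(2)
        by (intro sum.cong refl) (force simp: w_def h_def)
      also have "\<dots> = chi \<rho> g * of_real (q i) * h g i"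
        unfolding eig[OF i g] using d(2)[OF i] by (simp add: q_def h_def)
      finally show "(\<Sum>j<?r. of_real (w i j) * h g j) = chi \<rho> g * of_real (q i) * h g i" .
    qed
    then show ?thesis using d(2)[OF i] g by (simp add: h_def K)
  qed
  \<comment> \<open>Row orthogonality keeps only the term \<open>k = i\<close> of the average, which
    leaves \<open>card (carrier G)\<close> times the \<open>i\<close>-th diagonal entry of the
    averaging operator.\<close>
  have diag: "(\<Sum>g\<in>carrier G. chi (\<sigma>s ! i) (inv g) * (of_nat (d i) * average (h g) i)) =
      ?o * of_real (q i / (\<Sum>k\<in>comp i. q k))" if i: "i < ?r" for i
  proof -
    let ?q = "of_real (\<Sum>k\<in>comp i. q k) :: complex"
    have qh: "of_real (q k) * h g k = of_nat (d k) * chi (\<sigma>s ! k) g" if "k \<in> comp i" for g k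
      using d(2)[OF comp_less[OF that]] by (simp add: q_def h_def)
    have "(\<Sum>g\<in>carrier G. chi (\<sigma>s ! i) (inv g) * (of_nat (d i) * average (h g) i)) =
      (\<Sum>g\<in>carrier G. \<Sum>k\<in>comp i. of_nat (d i) / ?q *
        (of_nat (d k) * (chi (\<sigma>s ! k) g * chi (\<sigma>s ! i) (inv g))))"
      by (simp add: average_def qh sum_distrib_left sum_divide_distrib ac_simps del: of_real_sum)
    also have "\<dots> = (\<Sum>k\<in>comp i. of_nat (d i) / ?q *
        (of_nat (d k) * (\<Sum>g\<in>carrier G. chi (\<sigma>s ! k) g * chi (\<sigma>s ! i) (inv g))))"
      by (subst sum.swap) (simp only: sum_distrib_left)
    also have "\<dots> = (\<Sum>k\<in>comp i. if k = i then of_nat (d i) / ?q * (of_nat (d i) * ?o) else 0)"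
      using i comp_less
      by (intro sum.cong refl) (simp add: complete_irreps_orthogonality[OF \<sigma>s] del: of_real_sum)
    also have "\<dots> = ?o * of_real (q i / (\<Sum>k\<in>comp i. q k))"
      using i by (simp add: q_def del: of_real_sum)
    finally show ?thesis .
  qed
  \<comment> \<open>One double sum over \<open>i\<close> and \<open>g\<close> is evaluated in two
    ways: for fixed \<open>i\<close> by \<open>diag\<close>, which leads to the number of
    components, and for fixed \<open>g\<close> by \<open>avg\<close> and column orthogonality, which
    leads to the classes in the kernel.\<close>
  have "?o * of_nat (card (comp ` {..<?r})) =
      ?o * of_real (\<Sum>i<?r. q i / (\<Sum>k\<in>comp i. q k))"
    unfolding card_components_eq_sum[symmetric] by simp
  also have "\<dots> = (\<Sum>i<?r. \<Sum>g\<in>carrier G. chi (\<sigma>s ! i) (inv g) * (of_nat (d i) * average (h g) i))"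
    by (simp add: diag sum_distrib_left)
  also have "\<dots> = (\<Sum>g\<in>carrier G. \<Sum>i<?r. chi (\<sigma>s ! i) (inv g) * (of_nat (d i) * average (h g) i))"
    by (rule sum.swap)
  also have "\<dots> = (\<Sum>g\<in>carrier G. if g \<in> K then ?o * (1 / of_nat (card (conj_class g))) else 0)"
  proof (rule sum.cong[OF refl])
    fix g assume g: "g \<in> carrier G"
    show "(\<Sum>i<?r. chi (\<sigma>s ! i) (inv g) * (of_nat (d i) * average (h g) i)) =
        (if g \<in> K then ?o * (1 / of_nat (card (conj_class g))) else 0)"
      using column_orthogonality[OF \<sigma>s g g] conj_class_self[OF g] by (simp add: avg[OF g])
  qed
  also have "\<dots> = ?o * (\<Sum>g\<in>K. 1 / of_nat (card (conj_class g)))"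
    using K by (subst sum.inter_restrict[symmetric]) (auto simp: sum_distrib_left intro!: sum.cong)
  also have "(\<Sum>g\<in>K. 1 / of_nat (card (conj_class g))) =
      (of_nat (card {C \<in> conj_classes G. C \<subseteq> K}) :: complex)"
    using K chi_conjugate[OF \<rho>] by (intro card_conj_classes_eq_sum[symmetric]) auto
  finally have "(of_nat (card (comp ` {..<?r})) :: complex) = of_nat (card {C \<in> conj_classes G. C \<subseteq> K})"
    using card_carrier_nonzero by simp
  then show ?thesis unfolding sccs K_def by (rule of_nat_eq_iff[THEN iffD1])
qed

end

theorem proposition3p10:
  fixes G :: "('g, 'b) monoid_scheme"
    and \<rho> :: "'g \<Rightarrow> complex mat"
    and \<sigma>s :: "('g \<Rightarrow> complex mat) list"
  assumes "group G" and "finite (carrier G)"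
    and "representation G \<rho>"
    and "complete_irreps G \<sigma>s" and "trivial_rep G (\<sigma>s ! 0)"
  shows "card (pre_digraph.sccs (mckay_quiver G \<rho> \<sigma>s)) =
         card {C \<in> conj_classes G. C \<subseteq> kernel G (GL (rep_degree G \<rho>)) \<rho>}"
proof -
  interpret finite_group G
    using assms(1,2) by (simp add: finite_group_def finite_group_axioms_def)
  show ?thesis
    by (rule card_sccs_mckay_quiver[OF representation_iff_is_rep[THEN iffD1, OF assms(3)] assms(4)])
qed

end
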